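(* Let $G$ be a locally compact (Hausdorff) abelian metrizable group. Then $G$ admits a non-discrete UFSS group topology strictly finer than its given topology if and only if $G$ contains no open compact subgroup of finite exponent. This happens, for example, if $G$ is not totally disconnected.
   Context: $\mathbb N=\{1,2,\dots\}$. For a symmetric subset $U\ni 0$ of an abelian group $G$ and $n\in\mathbb N$ put $(1/n)U=\{x\in G: kx\in U\ \text{for all } k\in\{1,\dots,n\}\}$. A Hausdorff group topology on $G$ is UFSS (uniformly free from small subgroups) if for some neighborhood $U$ of $0$ (which may be taken symmetric) the sets $(1/n)U$, $n\in\mathbb N$, form a neighborhood basis at $0$. A group $K$ has finite exponent if $nK=\{0\}$ for some $n\in\mathbb N$. *)

theory Defs
  imports "HOL-Analysis.Analysis"
begin

text \<open>
  The abstract abelian group is a type of class \<^class>\<open>ab_group_add\<close>. Since several topologies on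
  the same group are compared, topologies are explicit objects of type \<^typ>\<open>'a topology\<close>
  and no topological type class is used.
\<close>

definition nmult :: "nat \<Rightarrow> 'a::ab_group_add \<Rightarrow> 'a" where
  "nmult k x = (\<Sum>i<k. x)"

definition add_subgroup :: "'a::ab_group_add set \<Rightarrow> bool" where
  "add_subgroup H \<longleftrightarrow> 0 \<in> H \<and> (\<forall>x\<in>H. \<forall>y\<in>H. x + y \<in> H) \<and> (\<forall>x\<in>H. - x \<in> H)"

definition finite_exponent :: "'a::ab_group_add set \<Rightarrow> bool" where
  "finite_exponent K \<longleftrightarrow> (\<exists>n\<ge>1. nmult n ` K = {0})"

text \<open>Group topologies are not required to be Hausdorff here; this is always stated separately.\<close>

definition group_topology :: "'a::ab_group_add topology \<Rightarrow> bool" where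
  "group_topology T \<longleftrightarrow>
     topspace T = UNIV \<and>
     continuous_map (prod_topology T T) T (\<lambda>(x, y). x + y) \<and>
     continuous_map T T (\<lambda>x. - x)"

definition nbhd_zero :: "'a::ab_group_add topology \<Rightarrow> 'a set \<Rightarrow> bool" where
  "nbhd_zero T U \<longleftrightarrow> (\<exists>V. openin T V \<and> 0 \<in> V \<and> V \<subseteq> U)"

definition inv_mult :: "nat \<Rightarrow> 'a::ab_group_add set \<Rightarrow> 'a set" where
  "inv_mult n U = {x. \<forall>k\<in>{1..n}. nmult k x \<in> U}"  \<comment> \<open>the set \<open>(1/n)U\<close>\<close>

definition UFSS :: "'a::ab_group_add topology \<Rightarrow> bool" where
  "UFSS T \<longleftrightarrow>
     group_topology T \<and> Hausdorff_space T \<and>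
     (\<exists>U. nbhd_zero T U \<and> uminus ` U = U \<and>
        (\<forall>n\<ge>1. nbhd_zero T (inv_mult n U)) \<and>
        (\<forall>W. nbhd_zero T W \<longrightarrow> (\<exists>n\<ge>1. inv_mult n U \<subseteq> W)))"

definition strictly_finer :: "'a topology \<Rightarrow> 'a topology \<Rightarrow> bool" where
  "strictly_finer S T \<longleftrightarrow> (\<forall>V. openin T V \<longrightarrow> openin S V) \<and> S \<noteq> T"

definition totally_disconnected_space :: "'a topology \<Rightarrow> bool" where
  "totally_disconnected_space T \<longleftrightarrow>
     (\<forall>x\<in>topspace T. connected_component_of_set T x = {x})"

end

theory Submission
  imports Defs
begin

text \<open>
  If \<open>K\<close> is an open subgroup of exponent \<open>N\<close> and \<open>(1/m)U \<subseteq> K\<close>, then the multiples of an element of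
  \<open>(1/m)U\<close> with \<open>m \<ge> N\<close> are periodic, hence all lie in \<open>U\<close>, and the element is \<open>0\<close>: a finer UFSS
  topology is discrete.

  Conversely, if no compact open subgroup has finite exponent, then no \<open>nmult N\<close> vanishes near \<open>0\<close>,
  and one finds \<open>y 0, y 1, \<dots>\<close> tending to \<open>0\<close> so fast that finite sums \<open>\<Sum> c i * y i\<close> over large \<open>i\<close>
  with \<open>\<bar>c i\<bar> \<le> i + 1\<close> are small, and so generic that \<open>\<Sum> c i * y i = 0\<close> with \<open>\<bar>c i\<bar> \<le> 3 * (i + 1)\<close>
  forces \<open>c = 0\<close>. Let \<open>U\<close> be the set of all finite sums with \<open>\<Sum> \<bar>c i\<bar> / (i + 1) \<le> 1\<close>. Uniqueness of the
  coefficients identifies \<open>(1/n)U\<close> with the sums of weight at most \<open>1/n\<close>, so these sets are the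
  neighborhood basis of a UFSS topology.

  A compact open subgroup of finite exponent is totally disconnected by a Fourier argument on its
  finite subgroups in the style of Bogolyubov's theorem.
\<close>

section \<open>Multiples and characters of finite abelian groups\<close>

lemma nmult_0 [simp]: "nmult 0 x = 0"
  and nmult_Suc: "nmult (Suc k) x = nmult k x + x"
  by (simp_all add: nmult_def)

lemma nmult_1 [simp]: "nmult (Suc 0) x = x" "nmult 1 x = x"
  by (simp_all add: nmult_def)

lemma nmult_zero_right [simp]: "nmult k 0 = 0"
  by (simp add: nmult_def)

lemma nmult_add_left: "nmult (k + l) x = nmult k x + nmult l x"
  by (induction l) (simp_all add: nmult_Suc add.assoc)

lemma nmult_add_right: "nmult k (x + y) = nmult k x + nmult k y"
  by (simp add: nmult_def sum.distrib)

lemma nmult_minus_right: "nmult k (- x) = - nmult k x"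
  by (simp add: nmult_def sum_negf)

lemma nmult_nmult: "nmult k (nmult l x) = nmult (k * l) x"
  by (induction k) (simp_all add: nmult_Suc nmult_add_left add.commute)

lemma nmult_mod:
  assumes "nmult n x = 0"
  shows "nmult (k mod n) x = nmult k x"
proof -
  have "nmult k x = nmult (n * (k div n) + k mod n) x" by simp
  also have "\<dots> = nmult (k mod n) x"
    by (simp only: nmult_add_left mult.commute[of n] nmult_nmult[symmetric] assms nmult_zero_right add_0)
  finally show ?thesis by simp
qed

text \<open>Since \<open>nat\<close> truncates negative numbers to \<open>0\<close>, at most one of
  the two terms is nontrivial; this is the usual action of the integers.\<close>

definition zmult :: "int \<Rightarrow> 'a::ab_group_add \<Rightarrow> 'a" where
  "zmult k x = nmult (nat k) x - nmult (nat (- k)) x"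

text \<open>Every integer is a difference of naturals, so this form spares \<open>zmult_add\<close>
  the case distinctions on signs.\<close>

lemma zmult_diff_of_nat: "zmult (int m - int n) x = nmult m x - nmult n x"
proof (cases "n \<le> m")
  case True
  then have "nmult m x = nmult (m - n) x + nmult n x"
    by (simp flip: nmult_add_left)
  with True show ?thesis
    by (simp add: zmult_def nat_diff_distrib' algebra_simps)
next
  case False
  then have "nmult n x = nmult (n - m) x + nmult m x"
    by (simp flip: nmult_add_left)
  with False show ?thesis
    by (simp add: zmult_def nat_diff_distrib' algebra_simps)
qed

lemma zmult_0 [simp]: "zmult 0 x = 0"
  and zmult_1 [simp]: "zmult 1 x = x"
  and zmult_of_nat: "zmult (int n) x = nmult n x"
  by (simp_all add: zmult_def)

lemma zmult_add: "zmult (k + l) x = zmult k x + zmult l x"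
proof -
  obtain a b where "k = int a - int b" by (metis int_diff_cases)
  moreover obtain c d where "l = int c - int d" by (metis int_diff_cases)
  moreover have "int a - int b + (int c - int d) = int (a + c) - int (b + d)" by simp
  ultimately show ?thesis
    by (simp only: zmult_diff_of_nat nmult_add_left) simp
qed

lemma zmult_minus: "zmult (- k) x = - zmult k x"
  by (simp add: zmult_def)

lemma zmult_diff: "zmult (k - l) x = zmult k x - zmult l x"
  using zmult_add[of k "- l" x] by (simp add: zmult_minus)

lemma nmult_zmult: "nmult n (zmult k x) = zmult (int n * k) x"
  by (induction n) (simp_all add: nmult_Suc zmult_add algebra_simps)

lemma nmult_sum: "nmult n (sum f A) = (\<Sum>i\<in>A. nmult n (f i))"
  unfolding nmult_def by (rule sum.swap)

lemma add_subgroup_0: "add_subgroup H \<Longrightarrow> 0 \<in> H"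
  and add_subgroup_add: "add_subgroup H \<Longrightarrow> x \<in> H \<Longrightarrow> y \<in> H \<Longrightarrow> x + y \<in> H"
  and add_subgroup_minus: "add_subgroup H \<Longrightarrow> x \<in> H \<Longrightarrow> - x \<in> H"
  by (auto simp: add_subgroup_def)

lemma add_subgroupI:
  assumes "0 \<in> H" "\<And>x y. x \<in> H \<Longrightarrow> y \<in> H \<Longrightarrow> x + y \<in> H" "\<And>x. x \<in> H \<Longrightarrow> - x \<in> H"
  shows "add_subgroup H"
  using assms by (simp add: add_subgroup_def)

lemma add_subgroup_diff: "add_subgroup H \<Longrightarrow> x \<in> H \<Longrightarrow> y \<in> H \<Longrightarrow> x - y \<in> H"
  using add_subgroup_add[of H x "- y"] by (simp add: add_subgroup_minus)

lemma add_subgroup_nmult: "add_subgroup H \<Longrightarrow> x \<in> H \<Longrightarrow> nmult k x \<in> H"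
  by (induction k) (auto simp: nmult_Suc add_subgroup_0 intro: add_subgroup_add)

lemma add_subgroup_add_cancel_left:
  assumes "add_subgroup H" "x \<in> H"
  shows "x + y \<in> H \<longleftrightarrow> y \<in> H"
  using add_subgroup_add[OF assms(1) add_subgroup_minus[OF assms], of "x + y"]
    add_subgroup_add[OF assms] by auto

lemma add_subgroup_hull: "add_subgroup (add_subgroup hull S)"
  by (rule hull_in) (auto simp: add_subgroup_def)

lemma finite_exponentE:
  assumes "finite_exponent K"
  obtains n where "n \<ge> 1" "\<forall>x\<in>K. nmult n x = 0"
  using assms unfolding finite_exponent_def by blast

section \<open>Orthogonal characters on finite torsion subgroups\<close>

text \<open>The functions \<open>\<psi> i\<close> with \<open>i < card D\<close> stand for the dual
  group of \<open>D\<close>, with the trivial character at index \<open>0\<close>. The last clause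
  is the orthogonality relation, through which completeness of the dual enters. That the values have
  modulus 1 is derived later from finite exponent, in \<open>norm_character\<close>.\<close>

definition character_system :: "'a::ab_group_add set \<Rightarrow> (nat \<Rightarrow> 'a \<Rightarrow> complex) \<Rightarrow> bool" where
  "character_system D \<psi> \<longleftrightarrow>
     (\<forall>i<card D. \<psi> i 0 = 1 \<and> (\<forall>x\<in>D. \<forall>y\<in>D. \<psi> i (x + y) = \<psi> i x * \<psi> i y)) \<and>
     (\<forall>x\<in>D. \<psi> 0 x = 1) \<and>
     (\<forall>x\<in>D. (\<Sum>i<card D. \<psi> i x) = (if x = 0 then of_nat (card D) else 0))"

text \<open>The root serves as the value of an extended character at a new generator; the second
  clause lets the trivial character extend to the trivial one.\<close>

lemma complex_root_exists:
  assumes "m > 0" "w \<noteq> 0"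
  shows "\<exists>z::complex. z ^ m = w \<and> (w = 1 \<longrightarrow> z = 1)"
proof (cases "w = 1")
  case True
  then show ?thesis by (intro exI[of _ 1]) simp
next
  case False
  have "exp (Ln w / of_nat m) ^ m = exp (of_nat m * (Ln w / of_nat m))"
    by (simp only: exp_of_nat_mult)
  with assms False show ?thesis by (intro exI[of _ "exp (Ln w / of_nat m)"]) simp
qed

lemma cis_root_of_unity:
  assumes "m > 0"
  shows "cis (2 * pi * real j / real m) ^ m = 1"
proof -
  have "cis (2 * pi * real j / real m) ^ m = cis (real m * (2 * pi * real j / real m))"
    by (simp only: Complex.DeMoivre)
  also have "real m * (2 * pi * real j / real m) = 2 * pi * real j"
    using assms by simp
  also have "cis \<dots> = 1" by (rule cis_multiple_2pi) simp
  finally show ?thesis .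
qed

text \<open>For \<open>k \<noteq> 0\<close> the sum is geometric, and its ratio is an
  \<open>m\<close>-th root of unity other than \<open>1\<close> because
  \<open>0 < k / m < 1\<close>.\<close>

lemma sum_powers_root_of_unity:
  assumes "k < m"
  shows "(\<Sum>j<m. (cis (2 * pi * real j / real m)) ^ k) = (if k = 0 then of_nat m else 0)"
proof (cases "k = 0")
  case False
  define q where "q = cis (2 * pi * real k / real m)"
  have "q \<noteq> 1"
  proof
    assume "q = 1"
    then have "cos (2 * pi * (real k / real m)) = 1"
      by (simp add: q_def complex_eq_iff)
    then obtain n :: int where "2 * pi * (real k / real m) = real_of_int n * 2 * pi"
      by (auto simp: cos_one_2pi_int)
    then have "2 * pi * (real k / real m) = 2 * pi * of_int n" by (simp only: mult_ac)
    then have "real k / real m = of_int n" by (subst (asm) mult_cancel_left) simp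
    moreover have "0 < real k / real m" "real k / real m < 1" using assms False by auto
    ultimately have "0 < real_of_int n" "real_of_int n < 1" by metis+
    then show False by simp
  qed
  moreover have "q ^ m = 1"
    using assms by (simp add: q_def cis_root_of_unity)
  ultimately have "(\<Sum>j<m. q ^ j) = 0" by (simp add: geometric_sum)
  moreover have "cis (2 * pi * real j / real m) ^ k = q ^ j" for j
    by (simp add: q_def Complex.DeMoivre algebra_simps)
  ultimately show ?thesis using False by simp
qed simp

text \<open>One index below \<open>n * m\<close> encodes a pair, so that pairs of an old character
  and a root of unity can be numbered by naturals.\<close>

lemma sum_div_mod:
  fixes g :: "nat \<Rightarrow> nat \<Rightarrow> 'b::comm_monoid_add"
  shows "(\<Sum>i<n * m. g (i div m) (i mod m)) = (\<Sum>a<n. \<Sum>b<m. g a b)"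
proof -
  have "(\<Sum>i<n * m. g (i div m) (i mod m)) = (\<Sum>a<n. \<Sum>i=a*m..<a*m+m. g (i div m) (i mod m))"
    by (rule sum.nat_group[symmetric])
  also have "\<dots> = (\<Sum>a<n. \<Sum>b<m. g a b)"
  proof (rule sum.cong[OF refl])
    fix a :: nat
    have "(\<Sum>i=a*m..<a*m+m. g (i div m) (i mod m)) = (\<Sum>b=0..<m. g ((b + a*m) div m) ((b + a*m) mod m))"
      using sum.shift_bounds_nat_ivl[of "\<lambda>i. g (i div m) (i mod m)" 0 "a*m" m]
      by (simp add: add.commute)
    also have "\<dots> = (\<Sum>b<m. g a b)"
      by (rule sum.cong) auto
    finally show "(\<Sum>i=a*m..<a*m+m. g (i div m) (i mod m)) = (\<Sum>b<m. g a b)" .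
  qed
  finally show ?thesis .
qed

text \<open>A character of \<open>D\<close> extends to the group generated by \<open>D\<close> and
  \<open>y\<close> in \<open>m\<close> ways, where \<open>m\<close> is the order of \<open>y\<close>
  modulo \<open>D\<close>: the value at \<open>y\<close> may be any \<open>m\<close>-th root of the
  value at \<open>nmult m y\<close>. Orthogonality upstairs combines orthogonality on
  \<open>D\<close> with that of the \<open>m\<close>-th roots of unity.\<close>

lemma character_system_adjoin:
  fixes y :: "'a::ab_group_add"
  assumes D: "add_subgroup D" "finite D" and ch: "character_system D \<psi>"
    and N: "N \<ge> 1" "nmult N y = 0"
  obtains D' \<psi>' where "add_subgroup D'" "finite D'" "D \<subseteq> D'" "y \<in> D'" "character_system D' \<psi>'"
    "\<And>H. add_subgroup H \<Longrightarrow> D \<subseteq> H \<Longrightarrow> y \<in> H \<Longrightarrow> D' \<subseteq> H"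
proof -
  define m where "m = (LEAST m. m \<ge> 1 \<and> nmult m y \<in> D)"
  have "N \<ge> 1 \<and> nmult N y \<in> D" using N add_subgroup_0[OF D(1)] by simp
  from LeastI[where P = "\<lambda>m. m \<ge> 1 \<and> nmult m y \<in> D", OF this] have m: "m \<ge> 1" "nmult m y \<in> D" unfolding m_def by blast+
  have least: "m \<le> k" if "k \<ge> 1" "nmult k y \<in> D" for k
    unfolding m_def using that by (auto intro: Least_le)
  define D' where "D' = (\<lambda>(d, k). d + nmult k y) ` (D \<times> {..<m})"
  have red: "d + nmult k y = (d + nmult (k div m) (nmult m y)) + nmult (k mod m) y" for d k
    by (simp add: nmult_nmult add.assoc flip: nmult_add_left)
  have redD: "d + nmult (k div m) (nmult m y) \<in> D" if "d \<in> D" for d k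
    using add_subgroup_add[OF D(1) that add_subgroup_nmult[OF D(1) m(2)]] .
  have D'I: "d + nmult k y \<in> D'" if "d \<in> D" for d k
    unfolding D'_def
  proof (rule image_eqI)
    show "d + nmult k y = (\<lambda>(d, k). d + nmult k y) (d + nmult (k div m) (nmult m y), k mod m)"
      using red[of d k] by simp
    show "(d + nmult (k div m) (nmult m y), k mod m) \<in> D \<times> {..<m}"
      using redD[OF that] m by simp
  qed
  \<comment> \<open>By minimality of \<open>m\<close>, the normal form \<open>d + nmult k y\<close>
    with \<open>k < m\<close> is unique, which gives the cardinality of \<open>D'\<close>.\<close>
  have inj: "inj_on (\<lambda>(d, k). d + nmult k y) (D \<times> {..<m})"
  proof -
    have aux: "k = l" if "d \<in> D" "e \<in> D" "k < m" "l < m" "d + nmult k y = e + nmult l y" "k \<le> l" for d e k l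
    proof (rule ccontr)
      assume "k \<noteq> l"
      with that have "l - k \<ge> 1" by simp
      have "nmult l y = nmult (l - k) y + nmult k y" using that by (simp flip: nmult_add_left)
      then have "nmult (l - k) y = d - e" using that(5) by (simp add: algebra_simps)
      then have "m \<le> l - k" using \<open>l - k \<ge> 1\<close> least add_subgroup_diff[OF D(1)] that by metis
      with that show False by simp
    qed
    show ?thesis
    proof (rule inj_onI, clarsimp)
      fix d k e l assume *: "d \<in> D" "k < m" "e \<in> D" "l < m" "d + nmult k y = e + nmult l y"
      then have "k = l"
        using aux[of d e k l] aux[of e d l k] by (cases "k \<le> l") auto
      with * show "d = e \<and> k = l" by simp
    qed
  qed
  have card: "card D' = card D * m"
    by (simp add: D'_def card_image[OF inj] card_cartesian_product)
  have hom: "\<psi> i (a + b) = \<psi> i a * \<psi> i b" "\<psi> i 0 = 1" if "i < card D" "a \<in> D" "b \<in> D" for i a b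
    using ch that by (auto simp: character_system_def)
  have triv: "\<psi> 0 a = 1" if "a \<in> D" for a using ch that by (auto simp: character_system_def)
  have cpos: "card D > 0" using D add_subgroup_0 card_gt_0_iff by blast
  have hom_nmult: "\<psi> i (nmult k a) = \<psi> i a ^ k" if "i < card D" "a \<in> D" for i a k
    using that by (induction k) (simp_all add: nmult_Suc hom add_subgroup_nmult[OF D(1)])
  have nz: "\<psi> i a \<noteq> 0" if "i < card D" "a \<in> D" for i a
    using hom[OF that add_subgroup_minus[OF D(1) that(2)]] by auto
  have "\<forall>i. \<exists>z::complex. i < card D \<longrightarrow> z ^ m = \<psi> i (nmult m y) \<and> (\<psi> i (nmult m y) = 1 \<longrightarrow> z = 1)"
    using complex_root_exists[of m] m nz by (metis less_eq_Suc_le One_nat_def)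
  then obtain r where r: "\<And>i. i < card D \<Longrightarrow> r i ^ m = \<psi> i (nmult m y)"
      "\<And>i. i < card D \<Longrightarrow> \<psi> i (nmult m y) = 1 \<Longrightarrow> r i = 1"
    by metis
  define \<zeta> where "\<zeta> j = cis (2 * pi * real j / real m)" for j
  have \<zeta>m: "\<zeta> j ^ m = 1" for j
    using m by (simp add: \<zeta>_def cis_root_of_unity)
  define p where "p = inv_into (D \<times> {..<m}) (\<lambda>(d, k). d + nmult k y)"
  have p: "p (d + nmult k y) = (d, k)" if "d \<in> D" "k < m" for d k
    using inv_into_f_f[OF inj, of "(d, k)"] that by (simp add: p_def)
  \<comment> \<open>The index \<open>i\<close> encodes the old character \<open>i div m\<close> and
    the chosen root of unity \<open>i mod m\<close>. Index \<open>0\<close> yields the trivial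
    character, since \<open>r 0 = 1\<close> and \<open>\<zeta> 0 = 1\<close>.\<close>
  define \<psi>' where "\<psi>' i x = \<psi> (i div m) (fst (p x)) * (r (i div m) * \<zeta> (i mod m)) ^ snd (p x)" for i x
  have idx: "i div m < card D" if "i < card D'" for i
    using that by (simp add: card less_mult_imp_div_less)
  \<comment> \<open>The formula is proved for every \<open>k\<close>, not only for
    \<open>k < m\<close>, so that multiplicativity of \<open>\<psi>' i\<close> can be read off
    without reducing sums modulo \<open>m\<close>.\<close>
  have val: "\<psi>' i (d + nmult k y) = \<psi> (i div m) d * (r (i div m) * \<zeta> (i mod m)) ^ k"
    if "d \<in> D" "i < card D'" for d k i
  proof -
    let ?i = "i div m" and ?w = "r (i div m) * \<zeta> (i mod m)"
    have "p (d + nmult k y) = (d + nmult (k div m) (nmult m y), k mod m)"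
      unfolding red[of d k] by (rule p[OF redD[OF that(1)]]) (use m in simp)
    then have "\<psi>' i (d + nmult k y) = \<psi> ?i d * \<psi> ?i (nmult m y) ^ (k div m) * ?w ^ (k mod m)"
      using idx[OF that(2)] that(1) m(2)
      by (simp add: \<psi>'_def hom hom_nmult add_subgroup_nmult[OF D(1)])
    also have "\<psi> ?i (nmult m y) = ?w ^ m"
      using r(1)[OF idx[OF that(2)]] by (simp add: power_mult_distrib \<zeta>m)
    also have "\<psi> ?i d * (?w ^ m) ^ (k div m) * ?w ^ (k mod m) = \<psi> ?i d * ?w ^ k"
      by (metis (no_types, lifting) mult.assoc power_add power_mult mult_div_mod_eq)
    finally show ?thesis .
  qed
  have D'E: "\<exists>d\<in>D. \<exists>k<m. x = d + nmult k y" if "x \<in> D'" for x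
    using that by (auto simp: D'_def)
  have minusy: "- nmult k y = nmult (k * (N - 1)) y" for k
  proof -
    have "nmult k y + nmult (k * (N - 1)) y = nmult (k * N) y"
      using N by (simp flip: nmult_add_left add: algebra_simps)
    also have "\<dots> = 0" by (simp only: nmult_nmult[symmetric] N nmult_zero_right)
    finally show ?thesis by (rule minus_unique)
  qed
  show thesis
  proof
    show "add_subgroup D'"
    proof (rule add_subgroupI)
      show "0 \<in> D'" using D'I[OF add_subgroup_0[OF D(1)], of 0] by simp
    next
      fix a b assume "a \<in> D'" "b \<in> D'"
      then obtain d k e l where *: "d \<in> D" "a = d + nmult k y" "e \<in> D" "b = e + nmult l y"
        using D'E by meson
      then have "a + b = (d + e) + nmult (k + l) y" by (simp add: nmult_add_left)
      then show "a + b \<in> D'" using D'I add_subgroup_add[OF D(1) *(1,3)] by metis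
    next
      fix a assume "a \<in> D'"
      then obtain d k where *: "d \<in> D" "a = d + nmult k y" using D'E by meson
      then have "- a = - d + nmult (k * (N - 1)) y" by (simp only: minusy[symmetric]) simp
      then show "- a \<in> D'" using D'I add_subgroup_minus[OF D(1) *(1)] by metis
    qed
    show "finite D'" using D by (simp add: D'_def)
    show "D \<subseteq> D'" using D'I[where k = 0] by auto
    show "y \<in> D'" using D'I[OF add_subgroup_0[OF D(1)], of 1] by simp
    show "D' \<subseteq> H" if "add_subgroup H" "D \<subseteq> H" "y \<in> H" for H
      using that by (auto simp: D'_def intro!: add_subgroup_add add_subgroup_nmult)
    show "character_system D' \<psi>'"
      unfolding character_system_def
    proof (intro conjI allI impI ballI)
      fix i assume i: "i < card D'"
      show "\<psi>' i 0 = 1"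
        using val[OF add_subgroup_0[OF D(1)] i, of 0] hom(2)[OF idx[OF i]] add_subgroup_0[OF D(1)] by auto
      fix a b assume "a \<in> D'" "b \<in> D'"
      then obtain d k e l where *: "d \<in> D" "a = d + nmult k y" "e \<in> D" "b = e + nmult l y"
        using D'E by meson
      then have "a + b = (d + e) + nmult (k + l) y" by (simp add: nmult_add_left)
      then have "\<psi>' i (a + b) = \<psi> (i div m) (d + e) * (r (i div m) * \<zeta> (i mod m)) ^ (k + l)"
        using val[OF add_subgroup_add[OF D(1) *(1,3)] i] by simp
      then show "\<psi>' i (a + b) = \<psi>' i a * \<psi>' i b"
        using * by (simp add: val i hom idx power_add)
    next
      fix a assume "a \<in> D'"
      then obtain d k where *: "d \<in> D" "a = d + nmult k y" using D'E by meson
      have "card D' > 0" using cpos m by (simp add: card)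
      then show "\<psi>' 0 a = 1"
        using * r(2)[of 0] cpos m by (simp add: val triv \<zeta>_def)
    next
      fix x assume "x \<in> D'"
      then obtain d k where *: "d \<in> D" "k < m" "x = d + nmult k y" using D'E by meson
      have "(\<Sum>i<card D'. \<psi>' i x) = (\<Sum>i<card D * m. \<psi> (i div m) d * (r (i div m) * \<zeta> (i mod m)) ^ k)"
        using * by (intro sum.cong) (simp_all add: val card)
      also have "\<dots> = (\<Sum>a<card D. \<Sum>b<m. \<psi> a d * (r a * \<zeta> b) ^ k)"
        by (rule sum_div_mod)
      also have "\<dots> = (\<Sum>a<card D. \<psi> a d * r a ^ k * (\<Sum>b<m. \<zeta> b ^ k))"
        by (simp add: sum_distrib_left power_mult_distrib mult.assoc)
      also have "\<dots> = (\<Sum>a<card D. \<psi> a d * r a ^ k) * (if k = 0 then of_nat m else 0)"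
        using sum_powers_root_of_unity[OF *(2)] by (simp add: \<zeta>_def sum_distrib_right)
      also have "\<dots> = (if k = 0 then if d = 0 then of_nat (card D) * of_nat m else 0 else 0)"
        using ch *(1) by (simp add: character_system_def)
      also have "\<dots> = (if x = 0 then of_nat (card D') else 0)"
      proof -
        have "x = 0 \<longleftrightarrow> d = 0 \<and> k = 0"
        proof
          assume "x = 0"
          then have "p x = (0, 0)" using p[OF add_subgroup_0[OF D(1)], of 0] m by simp
          then show "d = 0 \<and> k = 0" using p[OF *(1,2)] *(3) by simp
        qed (use * in simp)
        then show ?thesis by (auto simp: card)
      qed
      finally show "(\<Sum>i<card D'. \<psi>' i x) = (if x = 0 then of_nat (card D') else 0)" .
    qed
  qed
qed

text \<open>Generators are adjoined one at a time; the minimality clause carried through the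
  induction identifies the result with the hull.\<close>

lemma finite_subgroup_with_characters:
  fixes F :: "'a::ab_group_add set"
  assumes "finite F" and N: "N \<ge> 1" "\<And>x. x \<in> F \<Longrightarrow> nmult N x = 0"
  shows "finite (add_subgroup hull F) \<and> (\<exists>\<psi>. character_system (add_subgroup hull F) \<psi>)"
proof -
  have "\<exists>D \<psi>. add_subgroup D \<and> finite D \<and> F \<subseteq> D \<and> character_system D \<psi> \<and>
      (\<forall>H. add_subgroup H \<longrightarrow> F \<subseteq> H \<longrightarrow> D \<subseteq> H)"
    using assms(1) N(2)
  proof (induction F)
    case empty
    have "character_system {0::'a} (\<lambda>_ _. 1)" "add_subgroup {0::'a}"
      by (auto simp: character_system_def add_subgroup_def)
    then show ?case by (intro exI[of _ "{0}"] exI[of _ "\<lambda>_ _. 1"]) (auto simp: add_subgroup_0)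
  next
    case (insert y F)
    have "\<And>x. x \<in> F \<Longrightarrow> nmult N x = 0" and y: "nmult N y = 0" using insert.prems by simp_all
    from insert.IH[OF this(1)] obtain D \<psi> where *: "add_subgroup D" "finite D" "F \<subseteq> D"
      "character_system D \<psi>" "\<forall>H. add_subgroup H \<longrightarrow> F \<subseteq> H \<longrightarrow> D \<subseteq> H" by metis
    obtain D' \<psi>' where D': "add_subgroup D'" "finite D'" "D \<subseteq> D'" "y \<in> D'" "character_system D' \<psi>'"
      "\<And>H. add_subgroup H \<Longrightarrow> D \<subseteq> H \<Longrightarrow> y \<in> H \<Longrightarrow> D' \<subseteq> H"
      using character_system_adjoin[OF *(1,2,4) N(1) y] by metis
    have "insert y F \<subseteq> D'" using D'(3,4) *(3) by auto
    moreover have "\<forall>H. add_subgroup H \<longrightarrow> insert y F \<subseteq> H \<longrightarrow> D' \<subseteq> H"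
      using D'(6) *(5) by simp
    ultimately show ?case using D'(1,2,5) by metis
  qed
  then obtain D \<psi> where *: "add_subgroup D" "finite D" "F \<subseteq> D" "character_system D \<psi>"
      "\<forall>H. add_subgroup H \<longrightarrow> F \<subseteq> H \<longrightarrow> D \<subseteq> H" by metis
  have "add_subgroup hull F = D" by (rule hull_unique) (use * in auto)
  with * show ?thesis by metis
qed

section \<open>Topological abelian groups\<close>

context
  fixes T :: "'a::ab_group_add topology"
  assumes T: "group_topology T"
begin

lemma group_topology_topspace: "topspace T = UNIV"
  using T by (simp add: group_topology_def)

lemma continuous_map_group_add:
  assumes "continuous_map X T f" "continuous_map X T g"
  shows "continuous_map X T (\<lambda>x. f x + g x)"
proof -
  have "continuous_map X T ((\<lambda>(x, y). x + y) \<circ> (\<lambda>x. (f x, g x)))"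
    using T assms by (intro continuous_map_compose[OF continuous_map_pairedI])
      (auto simp: group_topology_def)
  then show ?thesis by (simp add: o_def)
qed

lemma continuous_map_group_minus:
  assumes "continuous_map X T f"
  shows "continuous_map X T (\<lambda>x. - f x)"
proof -
  have "continuous_map X T ((\<lambda>x. - x) \<circ> f)"
    using T assms by (intro continuous_map_compose) (auto simp: group_topology_def)
  then show ?thesis by (simp add: o_def)
qed

lemma continuous_map_group_const: "continuous_map X T (\<lambda>x. c)"
  by (simp add: group_topology_topspace)

lemma continuous_map_nmult:
  assumes "continuous_map X T f"
  shows "continuous_map X T (\<lambda>x. nmult n (f x))"
  by (induction n) (simp_all add: nmult_Suc assms continuous_map_group_add continuous_map_group_const del: continuous_map_const)

lemma openin_group_preimage:
  assumes "continuous_map T T f" "openin T V"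
  shows "openin T {x. f x \<in> V}"
  using openin_continuous_map_preimage[OF assms] by (simp add: group_topology_topspace)

lemma continuous_map_translation: "continuous_map T T (\<lambda>x. a + x)"
  using continuous_map_group_add[OF continuous_map_group_const continuous_map_id] by (simp add: id_def)

lemma openin_translation:
  assumes "openin T V"
  shows "openin T ((+) a ` V)"
proof -
  have "(+) a ` V = {x. - a + x \<in> V}"
    by (force simp: image_iff)
  then show ?thesis
    using openin_group_preimage[OF continuous_map_translation[of "- a"] assms] by metis
qed

lemma openin_add_split:
  assumes "openin T W" "a + b \<in> W"
  obtains U V where "openin T U" "openin T V" "a \<in> U" "b \<in> V" "\<forall>x\<in>U. \<forall>y\<in>V. x + y \<in> W"
proof -
  have "openin (prod_topology T T) {p \<in> topspace (prod_topology T T). (case p of (x, y) \<Rightarrow> x + y) \<in> W}"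
    by (rule openin_continuous_map_preimage[OF _ assms(1)]) (use T in \<open>simp add: group_topology_def\<close>)
  moreover have "(a, b) \<in> {p \<in> topspace (prod_topology T T). (case p of (x, y) \<Rightarrow> x + y) \<in> W}"
    using assms by (simp add: group_topology_topspace)
  ultimately obtain U V where "openin T U" "openin T V" "a \<in> U" "b \<in> V"
    "U \<times> V \<subseteq> {p \<in> topspace (prod_topology T T). (case p of (x, y) \<Rightarrow> x + y) \<in> W}"
    unfolding openin_prod_topology_alt by meson
  then show thesis by (intro that[of U V]) auto
qed

lemma openin_half:
  assumes "openin T W" "0 \<in> W"
  obtains V where "openin T V" "0 \<in> V" "\<forall>x\<in>V. \<forall>y\<in>V. x + y \<in> W"
proof -
  have "0 + 0 \<in> W" using assms by simp
  from openin_add_split[OF assms(1) this] obtain U V where "openin T U" "openin T V" "0 \<in> U" "0 \<in> V"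
    "\<forall>x\<in>U. \<forall>y\<in>V. x + y \<in> W" .
  then show thesis by (intro that[of "U \<inter> V"]) auto
qed

lemma openin_inv_mult:
  assumes "openin T W"
  shows "openin T (inv_mult n W)"
proof -
  have *: "openin T {x. nmult k x \<in> W}" for k
    using openin_group_preimage[OF continuous_map_nmult[OF continuous_map_id] assms] by simp
  have "inv_mult n W = {x. \<forall>k\<in>{1..n}. x \<in> {x. nmult k x \<in> W}}" by (auto simp: inv_mult_def)
  also have "\<dots> = (\<Inter>k\<in>{1..n}. {x. nmult k x \<in> W}) \<inter> topspace T"
    by (auto simp: group_topology_topspace)
  also have "openin T \<dots>"
    by (rule openin_INT) (use * in auto)
  finally show ?thesis .
qed

text \<open>The subgroup is the union of the translates of \<open>V\<close> by its own
  elements.\<close>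

lemma openin_subgroup_if_nbhd:
  assumes H: "add_subgroup H" and "openin T V" "0 \<in> V" "V \<subseteq> H"
  shows "openin T H"
proof -
  have "H = (\<Union>x\<in>H. (+) x ` V)"
  proof
    show "H \<subseteq> (\<Union>x\<in>H. (+) x ` V)" using assms by force
    show "(\<Union>x\<in>H. (+) x ` V) \<subseteq> H" using assms add_subgroup_add[OF H] by auto
  qed
  also have "openin T \<dots>" using assms openin_translation by (intro openin_Union) auto
  finally show ?thesis .
qed

text \<open>The complement is a union of cosets, each of which is open.\<close>

lemma closedin_open_subgroup:
  assumes H: "add_subgroup H" and "openin T H"
  shows "closedin T H"
proof -
  have "UNIV - H = (\<Union>x\<in>UNIV - H. (+) x ` H)"
  proof
    show "UNIV - H \<subseteq> (\<Union>x\<in>UNIV - H. (+) x ` H)" using add_subgroup_0[OF H] by force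
    show "(\<Union>x\<in>UNIV - H. (+) x ` H) \<subseteq> UNIV - H"
      using add_subgroup_diff[OF H] by fastforce
  qed
  also have "openin T \<dots>" using assms openin_translation by (intro openin_Union) auto
  finally show ?thesis by (simp add: closedin_def group_topology_topspace)
qed

section \<open>Compactness arguments: finite covers by translates, torsion neighborhoods, uniform
  continuity\<close>

lemma compactin_translates:
  assumes "compactin T C" "openin T V" "0 \<in> V"
  obtains F where "finite F" "F \<subseteq> C" "C \<subseteq> (\<Union>a\<in>F. (+) a ` V)"
proof -
  have "\<exists>\<F>. finite \<F> \<and> \<F> \<subseteq> (\<lambda>a. (+) a ` V) ` C \<and> C \<subseteq> \<Union>\<F>"
    using assms(1) unfolding compactin_def
  proof (elim conjE allE impE)
    show "(\<forall>U\<in>(\<lambda>a. (+) a ` V) ` C. openin T U) \<and> C \<subseteq> \<Union> ((\<lambda>a. (+) a ` V) ` C)"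
      using assms openin_translation by force
  qed
  then obtain \<F> where "finite \<F>" "\<F> \<subseteq> (\<lambda>a. (+) a ` V) ` C" "C \<subseteq> \<Union>\<F>" by blast
  then obtain F where "F \<subseteq> C" "finite F" "\<F> = (\<lambda>a. (+) a ` V) ` F"
    by (metis finite_subset_image)
  then show thesis using \<open>C \<subseteq> \<Union>\<F>\<close> by (intro that[of F]) auto
qed

text \<open>If \<open>nmult N\<close> vanishes on a compact neighborhood \<open>C\<close> of \<open>0\<close>, then \<open>C + C\<close> is covered by
  finitely many translates of \<open>C\<close>; the subgroup \<open>\<Phi>\<close> generated by the translating elements is
  finite, so that \<open>\<Phi> + C\<close> is a compact open subgroup.\<close>

lemma compact_open_subgroup_if_torsion_nbhd:
  assumes haus: "Hausdorff_space T" and loc: "locally_compact_space T"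
    and V: "openin T V" "0 \<in> V" and N: "N \<ge> 1" "\<And>x. x \<in> V \<Longrightarrow> nmult N x = 0"
  shows "\<exists>K. add_subgroup K \<and> openin T K \<and> compactin T K \<and> finite_exponent K"
proof -
  obtain U C0 where U: "openin T U" "compactin T C0" "0 \<in> U" "U \<subseteq> C0"
    using loc unfolding locally_compact_space_def group_topology_topspace by blast
  \<comment> \<open>The \<open>N\<close>-torsion elements form a closed subgroup. Cutting the
    compact neighborhood down to \<open>E\<close> keeps it compact and gives everything generated
    from it exponent \<open>N\<close>.\<close>
  define E :: "'a set" where "E = {x. nmult N x = 0}"
  have "closedin T {0}" using haus by (simp add: closedin_Hausdorff_singleton group_topology_topspace)
  then have "closedin T E"
    using closedin_continuous_map_preimage[OF continuous_map_nmult[OF continuous_map_id, of N], of "{0}"]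
    by (simp add: E_def group_topology_topspace)
  define C where "C = E \<inter> C0"
  have C: "compactin T C" unfolding C_def by (rule closed_Int_compactin) fact+
  have E: "add_subgroup E"
    by (auto simp: add_subgroup_def E_def nmult_add_right nmult_minus_right)
  define W where "W = U \<inter> V"
  have W: "openin T W" "0 \<in> W" "W \<subseteq> C" using U V N by (auto simp: W_def C_def E_def)
  define CC where "CC = (\<lambda>(x, y). x + y) ` (C \<times> C)"
  have add: "continuous_map (prod_topology T T) T (\<lambda>(x, y). x + y)" using T by (simp add: group_topology_def)
  have CC: "compactin T CC"
    unfolding CC_def by (rule image_compactin[OF _ add]) (simp add: compactin_Times C)
  from compactin_translates[OF CC W(1,2)] obtain F where F: "finite F" "F \<subseteq> CC" "CC \<subseteq> (\<Union>a\<in>F. (+) a ` W)" .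
  have "CC \<subseteq> E" using add_subgroup_add[OF E] by (auto simp: CC_def C_def)
  define \<Phi> where "\<Phi> = add_subgroup hull F"
  have F0: "nmult N x = 0" if "x \<in> F" for x using that \<open>CC \<subseteq> E\<close> F(2) by (auto simp: E_def)
  have \<Phi>: "finite \<Phi>" "add_subgroup \<Phi>" "F \<subseteq> \<Phi>"
    using finite_subgroup_with_characters[OF F(1) N(1) F0]
    by (auto simp: \<Phi>_def add_subgroup_hull hull_inc)
  have "\<Phi> \<subseteq> E" unfolding \<Phi>_def using E F(2) \<open>CC \<subseteq> E\<close> by (intro hull_minimal) auto
  define K where "K = (\<lambda>(x, y). x + y) ` (\<Phi> \<times> C)"
  have KI: "x + y \<in> K" if "x \<in> \<Phi>" "y \<in> C" for x y using that by (auto simp: K_def)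
  have KE: "K \<subseteq> E" using add_subgroup_add[OF E] \<open>\<Phi> \<subseteq> E\<close> by (auto simp: K_def C_def)
  have "compactin T \<Phi>" using \<Phi>(1) by (simp add: finite_imp_compactin group_topology_topspace)
  then have "compactin T K"
    unfolding K_def by (intro image_compactin[OF _ add]) (simp add: compactin_Times C)
  moreover have Kadd: "a + b \<in> K" if ab: "a \<in> K" "b \<in> K" for a b
  proof -
    obtain x y where a: "a = x + y" "x \<in> \<Phi>" "y \<in> C" using ab by (auto simp: K_def)
    obtain x' y' where b: "b = x' + y'" "x' \<in> \<Phi>" "y' \<in> C" using ab by (auto simp: K_def)
    have "y + y' \<in> CC" using a b by (auto simp: CC_def)
    then obtain z w where z: "z \<in> F" "w \<in> W" "y + y' = z + w" using F(3) by auto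
    \<comment> \<open>Here the cover of \<open>C + C\<close> pays off: the sum \<open>y + y'\<close>
      is again a single element of \<open>C\<close>, up to a correction \<open>z\<close> that
      \<open>\<Phi>\<close> absorbs.\<close>
    have "a + b = (x + x' + z) + w" using a b z by (metis add.assoc add.left_commute)
    moreover have "x + x' + z \<in> \<Phi>" using a b z \<Phi> by (meson add_subgroup_add subsetD)
    ultimately show ?thesis using KI z W(3) by auto
  qed
  moreover have "add_subgroup K"
  proof (rule add_subgroupI)
    show K0: "0 \<in> K" using KI[OF add_subgroup_0[OF \<Phi>(2)], of 0] W by auto
    fix a assume a: "a \<in> K"
    have "nmult k a \<in> K" for k by (induction k) (auto simp: nmult_Suc K0 Kadd a)
    \<comment> \<open>Inverses come from closure under addition, since \<open>- a\<close> is a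
      multiple of \<open>a\<close>.\<close>
    moreover have "a + nmult (N - 1) a = 0"
      using a KE N(1) nmult_Suc[of "N - 1" a] by (auto simp: E_def add.commute)
    then have "- a = nmult (N - 1) a" by (rule minus_unique)
    ultimately show "- a \<in> K" by simp
  qed (rule Kadd)
  moreover have "W \<subseteq> K" using KI[OF add_subgroup_0[OF \<Phi>(2)]] W by auto
  with \<open>add_subgroup K\<close> W have "openin T K" by (intro openin_subgroup_if_nbhd[of K W]) auto
  moreover have "finite_exponent K"
    unfolding finite_exponent_def
  proof (intro exI conjI)
    show "nmult N ` K = {0}" using KE add_subgroup_0[OF \<open>add_subgroup K\<close>] by (force simp: E_def)
  qed (use N in simp)
  ultimately show ?thesis by blast
qed

text \<open>Otherwise every \<open>x\<close> in \<open>W\<close> has a multiple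
  \<open>nmult k x\<close> in \<open>F\<close> with \<open>k \<le> n\<close>, so that
  \<open>nmult (fact n) x\<close> takes finitely many values on \<open>W\<close>. Excluding the
  nonzero ones is an open condition, and what remains is a neighborhood of \<open>0\<close> killed
  by \<open>fact n\<close>, contrary to \<open>nK\<close>.\<close>

lemma exists_multiples_avoiding_finite_set:
  assumes haus: "Hausdorff_space T" and loc: "locally_compact_space T"
    and nK: "\<not> (\<exists>K. add_subgroup K \<and> openin T K \<and> compactin T K \<and> finite_exponent K)"
    and W: "openin T W" "0 \<in> W" and F: "finite F"
  shows "\<exists>x\<in>W. \<forall>k\<in>{1..n}. nmult k x \<notin> F"
proof (rule ccontr)
  assume "\<not> ?thesis"
  then have *: "\<exists>k\<in>{1..n}. nmult k x \<in> F" if "x \<in> W" for x using that by blast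
  define N where "N = (fact n :: nat)"
  define F' where "F' = (\<Union>k\<in>{1..n}. nmult (N div k) ` F) - {0}"
  have "finite F'" using F by (simp add: F'_def)
  then have "closedin T F'"
    using haus by (simp add: closedin_Hausdorff_finite group_topology_topspace)
  then have "openin T (UNIV - F')" by (simp add: closedin_def group_topology_topspace)
  then have "openin T {x. nmult N x \<in> UNIV - F'}"
    using openin_group_preimage[OF continuous_map_nmult[OF continuous_map_id, of N], of "UNIV - F'"] by (simp only: id_apply)
  then have V: "openin T (W \<inter> {x. nmult N x \<in> UNIV - F'})" using W by blast
  have tors: "nmult N x = 0" if xW: "x \<in> W \<inter> {x. nmult N x \<in> UNIV - F'}" for x
  proof -
    obtain k where k: "k \<in> {1..n}" "nmult k x \<in> F" using * xW by blast
    then have "N = N div k * k" by (simp add: N_def dvd_fact)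
    then have "nmult N x = nmult (N div k) (nmult k x)" by (simp only: nmult_nmult)
    then show ?thesis using xW k by (auto simp: F'_def)
  qed
  have "0 \<in> W \<inter> {x. nmult N x \<in> UNIV - F'}" using W by (simp add: F'_def)
  moreover have "N \<ge> 1" by (simp add: N_def)
  ultimately show False
    using compact_open_subgroup_if_torsion_nbhd[OF haus loc V _ _ tors] nK by blast
qed

text \<open>The neighborhood \<open>W\<close> serves all points of \<open>K\<close> at once; this
  makes the later bound on Fourier coefficients uniform over all finite subgroups of
  \<open>K\<close>.\<close>

lemma uniform_continuity_on_compact:
  fixes f :: "'a \<Rightarrow> real"
  assumes K: "compactin T K" and f: "continuous_map T euclideanreal f" and e: "e > 0"
  obtains W where "openin T W" "0 \<in> W" "\<forall>a\<in>K. \<forall>w\<in>W. \<bar>f (a + w) - f a\<bar> < e"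
proof -
  have "\<exists>A B. openin T A \<and> openin T B \<and> a \<in> A \<and> 0 \<in> B \<and>
      (\<forall>x\<in>A. \<forall>w\<in>B. \<bar>f (x + w) - f x\<bar> < e)" for a
  proof -
    have o: "openin T {x \<in> topspace T. f x \<in> ball (f a) (e/2)}"
      by (rule openin_continuous_map_preimage[OF f]) simp
    have m: "a + 0 \<in> {x \<in> topspace T. f x \<in> ball (f a) (e/2)}"
      using e by (simp add: group_topology_topspace)
    from openin_add_split[OF o m] obtain A B where AB: "openin T A" "openin T B" "a \<in> A" "0 \<in> B"
      "\<forall>x\<in>A. \<forall>w\<in>B. x + w \<in> {x \<in> topspace T. f x \<in> ball (f a) (e/2)}" .
    have "\<bar>f (x + w) - f x\<bar> < e" if "x \<in> A" "w \<in> B" for x w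
      using AB(5)[rule_format, OF that] AB(5)[rule_format, OF that(1) AB(4)]
        dist_triangle_half_r[of "f a" "f (x + w)" e "f x"] by (simp add: dist_real_def)
    with AB show ?thesis by metis
  qed
  then obtain A B where AB: "\<And>a. openin T (A a)" "\<And>a. openin T (B a)" "\<And>a. a \<in> A a" "\<And>a. 0 \<in> B a"
      "\<And>a x w. x \<in> A a \<Longrightarrow> w \<in> B a \<Longrightarrow> \<bar>f (x + w) - f x\<bar> < e" by metis
  have "\<exists>\<F>. finite \<F> \<and> \<F> \<subseteq> A ` K \<and> K \<subseteq> \<Union>\<F>"
    using K unfolding compactin_def
  proof (elim conjE allE impE)
    show "(\<forall>U\<in>A ` K. openin T U) \<and> K \<subseteq> \<Union> (A ` K)" using AB by blast
  qed
  then obtain \<F> where \<F>: "finite \<F>" "\<F> \<subseteq> A ` K" "K \<subseteq> \<Union>\<F>" by blast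
  then obtain F where F: "finite F" "\<F> = A ` F" by (metis finite_subset_image)
  show thesis
  proof
    show "openin T ((\<Inter>a\<in>F. B a) \<inter> topspace T)"
      by (rule openin_INT) (use F AB in auto)
    show "0 \<in> (\<Inter>a\<in>F. B a) \<inter> topspace T" using AB by (simp add: group_topology_topspace)
    show "\<forall>x\<in>K. \<forall>w\<in>(\<Inter>a\<in>F. B a) \<inter> topspace T. \<bar>f (x + w) - f x\<bar> < e"
    proof (intro ballI)
      fix x w assume "x \<in> K" "w \<in> (\<Inter>a\<in>F. B a) \<inter> topspace T"
      then obtain a where "a \<in> F" "x \<in> A a" "w \<in> B a" using \<F> F by blast
      then show "\<bar>f (x + w) - f x\<bar> < e" using AB by blast
    qed
  qed
qed

end

section \<open>Compact groups of finite exponent\<close>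

text \<open>The hulls of finite subsets form a directed family, so their union is a subgroup. This
  reduces questions about a compact torsion group to its finite subgroups.\<close>

lemma add_subgroup_hull_finite:
  assumes "x \<in> add_subgroup hull A"
  shows "\<exists>F. finite F \<and> F \<subseteq> A \<and> x \<in> add_subgroup hull F"
proof -
  let ?H = "{x. \<exists>F. finite F \<and> F \<subseteq> A \<and> x \<in> add_subgroup hull F}"
  have "add_subgroup hull A \<subseteq> ?H"
  proof (rule hull_minimal)
    show "A \<subseteq> ?H"
    proof
      fix a assume "a \<in> A"
      then have "finite {a} \<and> {a} \<subseteq> A \<and> a \<in> add_subgroup hull {a}" by (simp add: hull_inc)
      then show "a \<in> ?H" by blast
    qed
    show "add_subgroup ?H"
    proof (rule add_subgroupI)
      have "finite {} \<and> {} \<subseteq> A \<and> 0 \<in> add_subgroup hull {}"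
        by (simp add: add_subgroup_0 add_subgroup_hull)
      then show "0 \<in> ?H" by blast
    next
      fix a b assume "a \<in> ?H" "b \<in> ?H"
      then obtain F G where "finite F" "F \<subseteq> A" "a \<in> add_subgroup hull F"
        "finite G" "G \<subseteq> A" "b \<in> add_subgroup hull G" by blast
      moreover from this have "a \<in> add_subgroup hull (F \<union> G)" "b \<in> add_subgroup hull (F \<union> G)"
        by (meson hull_mono subsetD Un_upper1 Un_upper2)+
      ultimately have "finite (F \<union> G) \<and> F \<union> G \<subseteq> A \<and> a + b \<in> add_subgroup hull (F \<union> G)"
        by (simp add: add_subgroup_add add_subgroup_hull)
      then show "a + b \<in> ?H" by blast
    next
      fix a assume "a \<in> ?H"
      then show "- a \<in> ?H" using add_subgroup_minus[OF add_subgroup_hull] by blast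
    qed
  qed
  with assms show ?thesis by blast
qed

section \<open>Fourier analysis on a finite subgroup\<close>

context
  fixes D :: "'a::ab_group_add set" and \<psi> :: "nat \<Rightarrow> 'a \<Rightarrow> complex" and N :: nat
  assumes D: "add_subgroup D" "finite D"
    and \<psi>: "character_system D \<psi>"
    and N: "N \<ge> 1" "\<And>a. a \<in> D \<Longrightarrow> nmult N a = 0"
begin

lemma character_add: "i < card D \<Longrightarrow> a \<in> D \<Longrightarrow> b \<in> D \<Longrightarrow> \<psi> i (a + b) = \<psi> i a * \<psi> i b"
  and character_0: "i < card D \<Longrightarrow> \<psi> i 0 = 1"
  and character_trivial: "a \<in> D \<Longrightarrow> \<psi> 0 a = 1"
  and character_sum: "a \<in> D \<Longrightarrow> (\<Sum>i<card D. \<psi> i a) = (if a = 0 then of_nat (card D) else 0)"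
  using \<psi> by (simp_all add: character_system_def)

lemma character_power:
  assumes "i < card D" "a \<in> D"
  shows "\<psi> i a ^ N = 1"
proof -
  have "\<psi> i (nmult k a) = \<psi> i a ^ k" for k
    by (induction k) (simp_all add: assms nmult_Suc character_0 character_add add_subgroup_nmult[OF D(1)])
  from this[of N] show ?thesis using assms by (simp add: N character_0)
qed

lemma norm_character:
  assumes "i < card D" "a \<in> D"
  shows "norm (\<psi> i a) = 1"
proof -
  have "norm (\<psi> i a) ^ N = 1 ^ N" using character_power[OF assms] by (metis norm_one norm_power power_one)
  then show ?thesis by (rule power_eq_imp_eq_base) (use N in auto)
qed

lemma cnj_character:
  assumes "i < card D" "a \<in> D"
  shows "cnj (\<psi> i a) = \<psi> i (- a)"
proof -
  have "\<psi> i a * \<psi> i (- a) = 1"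
    using character_add[OF assms add_subgroup_minus[OF D(1) assms(2)]] character_0[OF assms(1)] by simp
  moreover have "\<psi> i a * cnj (\<psi> i a) = 1"
    using norm_character[OF assms] by (simp add: complex_norm_square[symmetric])
  ultimately show ?thesis by (metis mult_cancel_left mult_zero_left zero_neq_one)
qed

definition fourier_coeff :: "('a \<Rightarrow> real) \<Rightarrow> nat \<Rightarrow> complex" where
  "fourier_coeff f i = (\<Sum>a\<in>D. of_real (f a) * \<psi> i a)"

text \<open>Conjugating a character value negates its argument, so the product of the coefficient
  with its conjugate involves only differences. Both the second and the fourth moment are expanded
  from this form.\<close>

lemma norm_fourier_coeff_square:
  assumes "i < card D"
  shows "of_real ((norm (fourier_coeff f i))\<^sup>2) =
    (\<Sum>p\<in>D \<times> D. of_real (f (fst p) * f (snd p)) * \<psi> i (fst p - snd p))"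
proof -
  have "of_real ((norm (fourier_coeff f i))\<^sup>2) = fourier_coeff f i * cnj (fourier_coeff f i)"
    by (rule complex_norm_square)
  also have "\<dots> = (\<Sum>a\<in>D. \<Sum>b\<in>D. of_real (f a) * \<psi> i a * (of_real (f b) * \<psi> i (- b)))"
    using assms by (simp add: fourier_coeff_def sum_product cnj_character)
  also have "\<dots> = (\<Sum>a\<in>D. \<Sum>b\<in>D. of_real (f a * f b) * \<psi> i (a - b))"
    using assms character_add[OF assms] add_subgroup_minus[OF D(1)]
    by (intro sum.cong refl) (metis (no_types, lifting) diff_conv_add_uminus mult.assoc mult.left_commute of_real_mult)
  finally show ?thesis by (simp add: sum.cartesian_product split_beta)
qed

text \<open>Summing the expansion over all characters leaves only the diagonal, by
  orthogonality.\<close>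

lemma parseval:
  fixes f :: "'a \<Rightarrow> real"
  shows "(\<Sum>i<card D. (norm (fourier_coeff f i))\<^sup>2) = card D * (\<Sum>a\<in>D. (f a)\<^sup>2)"
proof -
  have "complex_of_real (\<Sum>i<card D. (norm (fourier_coeff f i))\<^sup>2) =
      (\<Sum>i<card D. \<Sum>p\<in>D \<times> D. of_real (f (fst p) * f (snd p)) * \<psi> i (fst p - snd p))"
    unfolding of_real_sum by (intro sum.cong refl norm_fourier_coeff_square) simp
  also have "\<dots> = (\<Sum>p\<in>D \<times> D. of_real (f (fst p) * f (snd p)) * (\<Sum>i<card D. \<psi> i (fst p - snd p)))"
    by (subst sum.swap) (simp only: sum_distrib_left)
  also have "\<dots> = (\<Sum>p\<in>D \<times> D. if fst p = snd p then of_real (card D * (f (fst p))\<^sup>2) else 0)"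
    using character_sum add_subgroup_diff[OF D(1)] add_subgroup_0[OF D(1)]
    by (intro sum.cong) (auto simp: power2_eq_square)
  also have "\<dots> = (\<Sum>a\<in>D. \<Sum>b\<in>D. if a = b then of_real (card D * (f a)\<^sup>2) else 0)"
    by (simp add: sum.cartesian_product split_beta)
  also have "\<dots> = (\<Sum>a\<in>D. of_real (card D * (f a)\<^sup>2))"
    using D(2) by (intro sum.cong refl) simp
  also have "\<dots> = complex_of_real (card D * (\<Sum>a\<in>D. (f a)\<^sup>2))"
    by (simp add: sum_distrib_left)
  finally show ?thesis by (simp only: of_real_eq_iff)
qed

text \<open>By orthogonality the sum is \<open>card D\<close> times a weighted count of the
  quadruples with \<open>a - b + (c - d) = - x\<close>, and \<open>supp\<close> says that the
  support of \<open>f\<close> contains no such quadruple.\<close>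

lemma fourth_moment_eq_0:
  assumes x: "x \<in> D"
    and supp: "\<And>a b c d. f a \<noteq> 0 \<Longrightarrow> f b \<noteq> 0 \<Longrightarrow> f c \<noteq> 0 \<Longrightarrow> f d \<noteq> 0 \<Longrightarrow> a - b + (c - d) + x \<noteq> 0"
  shows "(\<Sum>i<card D. of_real (norm (fourier_coeff f i) ^ 4) * \<psi> i x) = 0"
proof -
  define h where "h p = complex_of_real (f (fst p) * f (snd p))" for p
  define \<delta> where "\<delta> p = fst p - snd p" for p :: "'a \<times> 'a"
  have \<delta>: "\<delta> p \<in> D" if "p \<in> D \<times> D" for p
    using that add_subgroup_diff[OF D(1)] by (auto simp: \<delta>_def)
  have "of_real (norm (fourier_coeff f i) ^ 4) * \<psi> i x =
      (\<Sum>p\<in>D \<times> D. \<Sum>q\<in>D \<times> D. h p * h q * \<psi> i (\<delta> p + \<delta> q + x))" if i: "i < card D" for i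
  proof -
    have "complex_of_real (norm (fourier_coeff f i) ^ 4) =
        of_real ((norm (fourier_coeff f i))\<^sup>2) * of_real ((norm (fourier_coeff f i))\<^sup>2)"
      by (simp flip: of_real_mult power_add)
    also have "\<dots> = (\<Sum>p\<in>D \<times> D. \<Sum>q\<in>D \<times> D. (h p * \<psi> i (\<delta> p)) * (h q * \<psi> i (\<delta> q)))"
      unfolding norm_fourier_coeff_square[OF i] sum_product h_def \<delta>_def ..
    finally have eq: "complex_of_real (norm (fourier_coeff f i) ^ 4) =
        (\<Sum>p\<in>D \<times> D. \<Sum>q\<in>D \<times> D. (h p * \<psi> i (\<delta> p)) * (h q * \<psi> i (\<delta> q)))" .
    have "complex_of_real (norm (fourier_coeff f i) ^ 4) * \<psi> i x = (\<Sum>p\<in>D \<times> D. \<Sum>q\<in>D \<times> D. (h p * \<psi> i (\<delta> p)) * (h q * \<psi> i (\<delta> q)) * \<psi> i x)"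
      unfolding eq by (simp only: sum_distrib_right)
    also have "\<dots> = (\<Sum>p\<in>D \<times> D. \<Sum>q\<in>D \<times> D. h p * h q * \<psi> i (\<delta> p + \<delta> q + x))"
    proof (intro sum.cong[OF refl])
      fix p q assume "p \<in> D \<times> D" "q \<in> D \<times> D"
      then have "\<psi> i (\<delta> p + \<delta> q + x) = \<psi> i (\<delta> p) * \<psi> i (\<delta> q) * \<psi> i x"
        using x i by (simp only: character_add add_subgroup_add[OF D(1)] \<delta>)
      then show "(h p * \<psi> i (\<delta> p)) * (h q * \<psi> i (\<delta> q)) * \<psi> i x = h p * h q * \<psi> i (\<delta> p + \<delta> q + x)"
        by (simp only: mult_ac)
    qed
    finally show ?thesis .
  qed
  then have "(\<Sum>i<card D. of_real (norm (fourier_coeff f i) ^ 4) * \<psi> i x) =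
      (\<Sum>i<card D. \<Sum>p\<in>D \<times> D. \<Sum>q\<in>D \<times> D. h p * h q * \<psi> i (\<delta> p + \<delta> q + x))"
    by (intro sum.cong refl) simp
  also have "\<dots> = (\<Sum>p\<in>D \<times> D. \<Sum>i<card D. \<Sum>q\<in>D \<times> D. h p * h q * \<psi> i (\<delta> p + \<delta> q + x))"
    by (rule sum.swap)
  also have "\<dots> = (\<Sum>p\<in>D \<times> D. \<Sum>q\<in>D \<times> D. \<Sum>i<card D. h p * h q * \<psi> i (\<delta> p + \<delta> q + x))"
    by (rule sum.cong[OF refl], rule sum.swap)
  also have "\<dots> = 0"
  proof (rule sum.neutral, rule ballI, rule sum.neutral, rule ballI)
    fix p q assume pq: "p \<in> D \<times> D" "q \<in> D \<times> D"
    have "(\<Sum>i<card D. h p * h q * \<psi> i (\<delta> p + \<delta> q + x)) = h p * h q * (\<Sum>i<card D. \<psi> i (\<delta> p + \<delta> q + x))"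
      by (simp only: sum_distrib_left)
    also have "\<dots> = h p * h q * (if \<delta> p + \<delta> q + x = 0 then of_nat (card D) else 0)"
      using pq x by (subst character_sum) (simp_all only: add_subgroup_add[OF D(1)] \<delta>)
    also have "\<dots> = 0"
      using supp[of "fst p" "snd p" "fst q" "snd q"] by (auto simp: h_def \<delta>_def)
    finally show "(\<Sum>i<card D. h p * h q * \<psi> i (\<delta> p + \<delta> q + x)) = 0" .
  qed
  finally show ?thesis .
qed

text \<open>The left side is the contribution of the trivial character to the fourth moment.
  Subtracting the vanishing moment twisted by \<open>x\<close> leaves the terms with factor
  \<open>1 - \<psi> i x\<close>, so only characters nontrivial at \<open>x\<close> count. For these,
  \<open>B\<close> bounds two of the four factors, and Parseval handles the other two.\<close>

lemma sum_power4_le: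
  assumes x: "x \<in> D"
    and f: "\<And>a. 0 \<le> f a" "\<And>a. f a \<le> 1"
    and supp: "\<And>a b c d. f a \<noteq> 0 \<Longrightarrow> f b \<noteq> 0 \<Longrightarrow> f c \<noteq> 0 \<Longrightarrow> f d \<noteq> 0 \<Longrightarrow> a - b + (c - d) + x \<noteq> 0"
    and B: "\<And>i. i < card D \<Longrightarrow> \<psi> i x \<noteq> 1 \<Longrightarrow> norm (fourier_coeff f i) \<le> B"
  shows "(\<Sum>a\<in>D. f a) ^ 4 \<le> 2 * B\<^sup>2 * (real (card D))\<^sup>2"
proof -
  let ?F = "\<lambda>i. norm (fourier_coeff f i)"
  have "card D > 0" using D add_subgroup_0 card_gt_0_iff by blast
  have "fourier_coeff f 0 = of_real (\<Sum>a\<in>D. f a)"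
    by (simp add: fourier_coeff_def character_trivial)
  then have "?F 0 = (\<Sum>a\<in>D. f a)" using f by (simp only: norm_of_real) (simp add: sum_nonneg)
  then have "(\<Sum>a\<in>D. f a) ^ 4 = ?F 0 ^ 4" by simp
  also have "\<dots> \<le> (\<Sum>i<card D. ?F i ^ 4)"
    using \<open>card D > 0\<close> by (intro member_le_sum) auto
  also have "\<dots> = norm (complex_of_real (\<Sum>i<card D. ?F i ^ 4))"
    by (simp only: norm_of_real) (simp add: sum_nonneg)
  also have "complex_of_real (\<Sum>i<card D. ?F i ^ 4) =
      (\<Sum>i<card D. of_real (?F i ^ 4)) - (\<Sum>i<card D. of_real (?F i ^ 4) * \<psi> i x)"
    using fourth_moment_eq_0[OF x supp] by simp
  also have "\<dots> = (\<Sum>i<card D. of_real (?F i ^ 4) * (1 - \<psi> i x))"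
    by (simp add: sum_subtractf right_diff_distrib)
  also have "norm \<dots> \<le> (\<Sum>i<card D. 2 * B\<^sup>2 * (?F i)\<^sup>2)"
  proof (rule sum_norm_le)
    fix i assume "i \<in> {..<card D}"
    then have i: "i < card D" by simp
    show "norm (of_real (?F i ^ 4) * (1 - \<psi> i x)) \<le> 2 * B\<^sup>2 * (?F i)\<^sup>2"
    proof (cases "\<psi> i x = 1")
      case False
      have "norm (1 - \<psi> i x) \<le> 2"
        using norm_triangle_ineq4[of 1 "\<psi> i x"] norm_character[OF i x] by simp
      moreover have "?F i ^ 4 \<le> B\<^sup>2 * (?F i)\<^sup>2"
      proof -
        have "?F i ^ 4 = (?F i)\<^sup>2 * (?F i)\<^sup>2" by (simp flip: power_add)
        also have "\<dots> \<le> B\<^sup>2 * (?F i)\<^sup>2"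
          using B[OF i False] by (intro mult_right_mono power_mono) auto
        finally show ?thesis .
      qed
      ultimately have "?F i ^ 4 * norm (1 - \<psi> i x) \<le> (B\<^sup>2 * (?F i)\<^sup>2) * 2"
        by (intro mult_mono) auto
      then show ?thesis by (simp add: norm_mult norm_power mult_ac)
    qed simp
  qed
  also have "\<dots> = 2 * B\<^sup>2 * (card D * (\<Sum>a\<in>D. (f a)\<^sup>2))"
    unfolding parseval[symmetric] by (rule sum_distrib_left[symmetric])
  also have "(\<Sum>a\<in>D. (f a)\<^sup>2) \<le> (\<Sum>a\<in>D. 1)"
    using f by (intro sum_mono) (simp add: power_le_one)
  then have "2 * B\<^sup>2 * (card D * (\<Sum>a\<in>D. (f a)\<^sup>2)) \<le> 2 * B\<^sup>2 * (real (card D) * real (card D))"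
    by (intro mult_left_mono) simp_all
  finally show ?thesis by (simp add: power2_eq_square)
qed

text \<open>Replacing \<open>a\<close> by \<open>a + w\<close> in the sum shows that the coefficient
  times \<open>1 - \<psi> i w\<close> is, up to the factor \<open>\<psi> i w\<close>, the
  coefficient of the difference between the translate of \<open>f\<close> and
  \<open>f\<close>.\<close>

lemma norm_fourier_coeff_shift_le:
  assumes i: "i < card D" and w: "w \<in> D" and e: "\<And>a. a \<in> D \<Longrightarrow> \<bar>f (a + w) - f a\<bar> \<le> e"
  shows "norm (fourier_coeff f i) * norm (1 - \<psi> i w) \<le> e * card D"
proof -
  have bij: "bij_betw (\<lambda>a. a + w) D D"
    using add_subgroup_add[OF D(1) _ w] add_subgroup_diff[OF D(1) _ w]
    by (intro bij_betwI[where g = "\<lambda>a. a - w"]) auto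
  have "fourier_coeff f i = (\<Sum>a\<in>D. of_real (f (a + w)) * \<psi> i (a + w))"
    unfolding fourier_coeff_def by (rule sum.reindex_bij_betw[OF bij, symmetric])
  also have "\<dots> = (\<Sum>a\<in>D. of_real (f (a + w)) * (\<psi> i w * \<psi> i a))"
    using w i by (intro sum.cong refl) (simp add: character_add)
  finally have "fourier_coeff f i * (1 - \<psi> i w) =
      (\<Sum>a\<in>D. of_real (f (a + w)) * (\<psi> i w * \<psi> i a)) - (\<Sum>a\<in>D. of_real (f a) * \<psi> i a) * \<psi> i w"
    by (metis (no_types, lifting) fourier_coeff_def mult.right_neutral right_diff_distrib)
  also have "\<dots> = (\<Sum>a\<in>D. of_real (f (a + w) - f a) * (\<psi> i w * \<psi> i a))"
    unfolding sum_distrib_right sum_subtractf[symmetric]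
    by (intro sum.cong refl) (simp add: algebra_simps)
  also have "norm \<dots> \<le> (\<Sum>a\<in>D. e)"
    by (rule sum_norm_le) (simp only: norm_mult norm_of_real norm_character[OF i] w, simp add: e)
  finally show ?thesis by (simp add: norm_mult mult.commute)
qed

end

text \<open>A character that is nontrivial at \<open>x\<close> and has a large Fourier coefficient on a bump
  function \<open>f\<close> varies little where \<open>f\<close> does; since its values are \<open>N\<close>-th roots of unity, it is
  trivial there. A fourth-moment argument as in Bogolyubov's theorem provides such a character on
  finite subgroups, with bounds that do not depend on the finite subgroup.\<close>

lemma exists_nbhd_not_generating:
  fixes T :: "'a::ab_group_add topology"
  assumes T: "group_topology T" and haus: "Hausdorff_space T" and reg: "completely_regular_space T"
    and K: "add_subgroup K" "openin T K" "compactin T K" "finite_exponent K"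
    and x: "x \<in> K" "x \<noteq> 0"
  shows "\<exists>W. openin T W \<and> 0 \<in> W \<and> x \<notin> add_subgroup hull W"
proof -
  note [simp] = group_topology_topspace[OF T]
  from finite_exponentE[OF K(4)] obtain N where N0: "N \<ge> 1" "\<forall>y\<in>K. nmult N y = 0" .
  then have N: "N \<ge> 1" "\<And>y. y \<in> K \<Longrightarrow> nmult N y = 0" by simp_all
  \<comment> \<open>Two halvings produce a symmetric neighborhood \<open>V\<close> such that
    \<open>V - V + V - V\<close> misses \<open>- x\<close>, as the fourth-moment lemma requires of
    the support of \<open>f\<close>.\<close>
  have "closedin T {- x}" using haus by (simp add: closedin_Hausdorff_singleton)
  then have "openin T (UNIV - {- x})" "0 \<in> UNIV - {- x}" using x by (simp_all add: closedin_def)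
  from openin_half[OF T this] obtain V1 where
    V1: "openin T V1" "0 \<in> V1" "\<forall>a\<in>V1. \<forall>b\<in>V1. a + b \<in> UNIV - {- x}" .
  from openin_half[OF T V1(1,2)] obtain V2 where
    V2: "openin T V2" "0 \<in> V2" "\<forall>a\<in>V2. \<forall>b\<in>V2. a + b \<in> V1" .
  define V where "V = V2 \<inter> {a. - a \<in> V2}"
  have "openin T {a. - a \<in> V2}"
    using openin_group_preimage[OF T continuous_map_group_minus[OF T continuous_map_id] V2(1)] by simp
  then have V: "openin T V" "0 \<in> V" using V2 by (auto simp: V_def)
  have avoid: "a - b + (c - d) + x \<noteq> 0" if abcd: "a \<in> V" "b \<in> V" "c \<in> V" "d \<in> V" for a b c d
  proof -
    have "a + - b \<in> V1" "c + - d \<in> V1" using abcd V2(3) by (auto simp: V_def)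
    from V1(3)[rule_format, OF this] show ?thesis by (auto simp: add_eq_0_iff2)
  qed
  have "closedin T (UNIV - V)" using V(1) by (simp add: closedin_def Diff_Diff_Int)
  then obtain g :: "'a \<Rightarrow> real" where g: "continuous_map T (top_of_set {0..1}) g" "g 0 = 0"
    "g ` (UNIV - V) \<subseteq> {1}"
    using reg V(2) unfolding completely_regular_space_def by (metis DiffD2 DiffI UNIV_I group_topology_topspace[OF T])
  define f where "f a = 1 - g a" for a
  have gcont: "continuous_map T euclideanreal g" using g(1) continuous_map_in_subtopology by blast
  have "g a \<in> {0..1}" for a
    using g(1) by (auto simp: continuous_map_def Pi_iff)
  then have f01: "0 \<le> f a" "f a \<le> 1" for a by (simp_all add: f_def)
  have fcont: "continuous_map T euclideanreal f"
    unfolding f_def by (intro continuous_intros gcont)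
  have fV: "a \<in> V" if "f a \<noteq> 0" for a using that g(3) by (force simp: f_def)
  define P where "P = {a. f a > 1/2}"
  have "openin T {a \<in> topspace T. f a \<in> {1/2<..}}"
    by (rule openin_continuous_map_preimage[OF fcont]) simp
  then have P: "openin T P" "0 \<in> P" by (simp_all add: P_def f_def g)
  from compactin_translates[OF T K(3) P] obtain F where
    F: "finite F" "F \<subseteq> K" "K \<subseteq> (\<Union>b\<in>F. (+) b ` P)" .
  have "F \<noteq> {}" using F(3) add_subgroup_0[OF K(1)] by blast
  then have M: "card F > 0" using F(1) by (simp add: card_gt_0_iff)
  \<comment> \<open>A density bound: any finite subgroup \<open>D\<close> of \<open>K\<close>
    containing \<open>F\<close> is covered by \<open>card F\<close> translates of
    \<open>D \<inter> P\<close>, where \<open>f > 1/2\<close>, so \<open>f\<close> sums to at least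
    \<open>\<delta> * card D\<close> on it.\<close>
  define \<delta> where "\<delta> = 1 / (2 * real (card F))"
  have \<delta>: "\<delta> > 0" using M by (simp add: \<delta>_def)
  \<comment> \<open>Character values are \<open>N\<close>-th roots of unity, so those other than
    \<open>1\<close> stay at distance at least \<open>\<eta>\<close> from \<open>1\<close>.\<close>
  have "finite {z::complex. z ^ N = 1}" using N by (intro finite_roots_unity) simp
  from finite_set_avoid[OF this, of 1] obtain \<eta> where
    \<eta>: "\<eta> > 0" "\<And>z::complex. z ^ N = 1 \<Longrightarrow> z \<noteq> 1 \<Longrightarrow> \<eta> \<le> norm (1 - z)"
    by (auto simp: dist_norm)
  \<comment> \<open>With this \<open>e\<close>, the coefficients at characters nontrivial at
    \<open>x\<close> are at most \<open>\<delta>\<^sup>2 * card D / 2\<close>, which turns the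
    fourth-moment bound into \<open>(\<delta> * card D) ^ 4 / 2\<close> and contradicts the density
    bound.\<close>
  define e where "e = \<eta> * \<delta>\<^sup>2 / 2"
  have "e > 0" using \<delta> \<eta> by (simp add: e_def)
  from uniform_continuity_on_compact[OF T K(3) fcont this] obtain W where
    W: "openin T W" "0 \<in> W" "\<forall>a\<in>K. \<forall>w\<in>W. \<bar>f (a + w) - f a\<bar> < e" .
  have "x \<notin> add_subgroup hull (W \<inter> K)"
  proof
    assume "x \<in> add_subgroup hull (W \<inter> K)"
    from add_subgroup_hull_finite[OF this] obtain W0 where
      W0: "finite W0" "W0 \<subseteq> W \<inter> K" "x \<in> add_subgroup hull W0" by blast
    \<comment> \<open>Including \<open>F\<close> secures the density bound, whatever the finite set
      \<open>W0\<close> is.\<close>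
    define D where "D = add_subgroup hull (F \<union> W0)"
    have tors: "nmult N a = 0" if "a \<in> F \<union> W0" for a using that N(2) F(2) W0(2) by blast
    have fin: "finite (F \<union> W0)" using F(1) W0(1) by simp
    obtain \<psi> where D: "finite D" "character_system D \<psi>"
      using finite_subgroup_with_characters[OF fin N(1) tors] unfolding D_def by blast
    have D': "add_subgroup D" "D \<subseteq> K" "F \<union> W0 \<subseteq> D"
      using F(2) W0(2) K(1) by (auto simp: D_def add_subgroup_hull hull_inc intro: hull_minimal[THEN subsetD, rotated 2])
    have tD: "nmult N a = 0" if "a \<in> D" for a using that D'(2) N(2) by blast
    have xD: "x \<in> D" using W0(3) unfolding D_def by (meson Un_upper2 hull_mono subsetD)
    note ctx = D'(1) D(1,2) N(1) tD
    let ?n = "real (card D)"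
    have npos: "?n > 0" using D(1) xD card_gt_0_iff[of D] by auto
    have "D \<subseteq> (\<Union>b\<in>F. (+) b ` (D \<inter> P))"
    proof
      fix a assume "a \<in> D"
      then obtain b p where bp: "b \<in> F" "p \<in> P" "a = b + p" using D'(2) F(3) by blast
      then have "p \<in> D" using \<open>a \<in> D\<close> D'(1,3) add_subgroup_add_cancel_left[of D b p] by auto
      then show "a \<in> (\<Union>b\<in>F. (+) b ` (D \<inter> P))" using bp by blast
    qed
    then have "card D \<le> card (\<Union>b\<in>F. (+) b ` (D \<inter> P))" using F(1) D(1) by (intro card_mono) auto
    also have "\<dots> \<le> (\<Sum>b\<in>F. card ((+) b ` (D \<inter> P)))" using F(1) by (rule card_UN_le)
    also have "\<dots> \<le> (\<Sum>b\<in>F. card (D \<inter> P))" using D(1) by (intro sum_mono card_image_le) simp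
    also have "\<dots> = card F * card (D \<inter> P)" by simp
    finally have "?n \<le> real (card F) * real (card (D \<inter> P))" by (metis of_nat_le_iff of_nat_mult)
    then have "\<delta> * ?n \<le> card (D \<inter> P) / 2" using M by (simp add: \<delta>_def field_simps)
    also have "\<dots> = (\<Sum>a\<in>D \<inter> P. 1/2)" by simp
    also have "\<dots> \<le> (\<Sum>a\<in>D \<inter> P. f a)" by (intro sum_mono) (auto simp: P_def)
    also have "\<dots> \<le> (\<Sum>a\<in>D. f a)" using D(1) f01 by (intro sum_mono2) auto
    finally have low: "\<delta> * ?n \<le> (\<Sum>a\<in>D. f a)" .
    have up: "(\<Sum>a\<in>D. f a) ^ 4 \<le> 2 * (\<delta>\<^sup>2 * ?n / 2)\<^sup>2 * ?n\<^sup>2"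
    proof (rule sum_power4_le[OF ctx xD f01])
      show "a - b + (c - d) + x \<noteq> 0" if "f a \<noteq> 0" "f b \<noteq> 0" "f c \<noteq> 0" "f d \<noteq> 0" for a b c d
        using avoid fV that by blast
    next
      fix i assume i: "i < card D" "\<psi> i x \<noteq> 1"
      \<comment> \<open>The kernel of a character is a subgroup; if it contained \<open>W0\<close>,
        it would contain \<open>x\<close>.\<close>
      have "\<exists>w\<in>W0. \<psi> i w \<noteq> 1"
      proof (rule ccontr)
        assume neg: "\<not> ?thesis"
        have "add_subgroup {a \<in> D. \<psi> i a = 1}"
        proof (rule add_subgroupI)
          fix a assume "a \<in> {a \<in> D. \<psi> i a = 1}"
          then show "- a \<in> {a \<in> D. \<psi> i a = 1}"
            using cnj_character[OF ctx i(1), of a] add_subgroup_minus[OF D'(1)] by auto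
        qed (use D'(1) character_add[OF ctx i(1)] character_0[OF ctx i(1)] in \<open>auto simp: add_subgroup_def\<close>)
        then have "add_subgroup hull W0 \<subseteq> {a \<in> D. \<psi> i a = 1}"
          using neg D'(3) by (intro hull_minimal) auto
        then show False using W0(3) i(2) by blast
      qed
      then obtain w where w: "w \<in> W0" "\<psi> i w \<noteq> 1" by blast
      then have wD: "w \<in> D" using D'(3) by blast
      have "norm (fourier_coeff D \<psi> f i) * \<eta> \<le> norm (fourier_coeff D \<psi> f i) * norm (1 - \<psi> i w)"
        using \<eta>(2)[OF character_power[OF ctx i(1) wD] w(2)] by (intro mult_left_mono) auto
      also have "\<dots> \<le> e * ?n"
      proof (rule norm_fourier_coeff_shift_le[OF ctx i(1) wD])
        fix a assume "a \<in> D"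
        then show "\<bar>f (a + w) - f a\<bar> \<le> e" using W(3)[rule_format, of a w] D'(2) w W0(2) by force
      qed
      finally show "norm (fourier_coeff D \<psi> f i) \<le> \<delta>\<^sup>2 * ?n / 2"
        using \<eta>(1) by (simp add: e_def field_simps)
    qed
    have "(\<delta> * ?n) ^ 4 \<le> (\<Sum>a\<in>D. f a) ^ 4" using low \<delta> by (intro power_mono) auto
    also note up
    also have "2 * (\<delta>\<^sup>2 * ?n / 2)\<^sup>2 * ?n\<^sup>2 = (\<delta> * ?n) ^ 4 / 2"
      by (simp add: power2_eq_square power4_eq_xxxx)
    finally have "(\<delta> * ?n) ^ 4 \<le> 0" by simp
    moreover have "(\<delta> * ?n) ^ 4 > 0" using \<delta> npos by simp
    ultimately show False by simp
  qed
  then show ?thesis using W K add_subgroup_0[OF K(1)] by (intro exI[of _ "W \<inter> K"]) auto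
qed

text \<open>Open subgroups are clopen, so a connected set through \<open>0\<close> lies in all of
  them: first in \<open>K\<close>, then in the subgroup generated by any neighborhood of
  \<open>0\<close>, and some such subgroup omits any given nonzero element of \<open>K\<close>.
  Other points are moved to \<open>0\<close> by translation.\<close>

lemma totally_disconnected_if_compact_open_torsion_subgroup:
  fixes T :: "'a::ab_group_add topology"
  assumes T: "group_topology T" and haus: "Hausdorff_space T" and reg: "completely_regular_space T"
    and K: "add_subgroup K" "openin T K" "compactin T K" "finite_exponent K"
  shows "totally_disconnected_space T"
proof -
  note [simp] = group_topology_topspace[OF T]
  have 0: "y = 0" if C: "connectedin T C" "0 \<in> C" "y \<in> C" for C y
  proof (rule ccontr)
    assume "y \<noteq> 0"
    have clopen: "C \<subseteq> H" if H: "add_subgroup H" "openin T H" for H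
    proof -
      have "C \<inter> H \<noteq> {}" using C add_subgroup_0[OF H(1)] by blast
      with connectedin_clopen_cases[OF C(1) closedin_open_subgroup[OF T H] H(2)]
      show ?thesis by (auto simp: disjnt_def)
    qed
    have "y \<in> K" using clopen[OF K(1,2)] C by blast
    from exists_nbhd_not_generating[OF T haus reg K this \<open>y \<noteq> 0\<close>] obtain W where
      W: "openin T W" "0 \<in> W" "y \<notin> add_subgroup hull W" by blast
    have "openin T (add_subgroup hull W)"
      by (rule openin_subgroup_if_nbhd[OF T add_subgroup_hull W(1,2) hull_subset])
    then show False using clopen[OF add_subgroup_hull] C W by blast
  qed
  show ?thesis
    unfolding totally_disconnected_space_def
  proof
    fix x
    have "y = x" if xy: "connected_component_of T x y" for y
    proof -
      obtain C where C: "connectedin T C" "x \<in> C" "y \<in> C" using xy by (auto simp: connected_component_of_def)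
      have "connectedin T ((+) (- x) ` C)"
        by (rule connectedin_continuous_map_image[OF continuous_map_translation[OF T] C(1)])
      then have "- x + y = 0" using C by (intro 0[of "(+) (- x) ` C"]) force+
      then show ?thesis by (simp add: algebra_simps)
    qed
    then show "connected_component_of_set T x = {x}" by (auto simp: connected_component_of_refl)
  qed
qed

section \<open>Group topologies from neighborhood bases\<close>

text \<open>Open sets are those that contain, with each \<open>x\<close>, some translate
  \<open>x + B n\<close>. The sets \<open>B n\<close> need not be open; \<open>half\<close> makes
  their translates neighborhoods and addition continuous, while \<open>sep\<close> gives the
  Hausdorff property.\<close>

lemma group_topology_from_base:
  fixes B :: "nat \<Rightarrow> 'a::ab_group_add set"
  assumes B0: "\<And>n. 0 \<in> B n" and mono: "\<And>m n. m \<le> n \<Longrightarrow> B n \<subseteq> B m"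
    and neg: "\<And>n x. x \<in> B n \<Longrightarrow> - x \<in> B n"
    and half: "\<And>n. \<exists>m. \<forall>x\<in>B m. \<forall>y\<in>B m. x + y \<in> B n"
    and sep: "\<And>x. (\<And>n. x \<in> B n) \<Longrightarrow> x = 0"
  obtains S where "group_topology S" "Hausdorff_space S" "\<forall>W. nbhd_zero S W \<longleftrightarrow> (\<exists>n. B n \<subseteq> W)"
proof -
  define P where "P V \<longleftrightarrow> (\<forall>x\<in>V. \<exists>n. \<forall>u\<in>B n. x + u \<in> V)" for V
  define S where "S = topology P"
  have "istopology P"
    unfolding istopology_def
  proof (intro conjI allI impI)
    fix V W assume VW: "P V" "P W"
    show "P (V \<inter> W)"
      unfolding P_def
    proof
      fix x assume "x \<in> V \<inter> W"
      then obtain m n where mn: "\<forall>u\<in>B m. x + u \<in> V" "\<forall>u\<in>B n. x + u \<in> W"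
        using VW unfolding P_def by blast
      have "B (max m n) \<subseteq> B m" "B (max m n) \<subseteq> B n" by (intro mono; simp)+
      with mn have "\<forall>u\<in>B (max m n). x + u \<in> V \<inter> W" by blast
      then show "\<exists>n. \<forall>u\<in>B n. x + u \<in> V \<inter> W" by blast
    qed
  next
    fix \<K> assume "\<forall>K\<in>\<K>. P K"
    then show "P (\<Union>\<K>)" unfolding P_def by (meson UnionE UnionI)
  qed
  then have openS: "openin S V \<longleftrightarrow> P V" for V by (simp add: S_def)
  have "P UNIV" by (simp add: P_def)
  then have top: "topspace S = UNIV" using openS openin_subset by blast
  have inner: "\<exists>V. openin S V \<and> x \<in> V \<and> V \<subseteq> W" if W: "\<forall>u\<in>B n. x + u \<in> W" for x n W
  proof (intro exI conjI)
    \<comment> \<open>This is the interior of \<open>W\<close>; halving a basic set shows that it is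
      open.\<close>
    let ?V = "{y. \<exists>m. \<forall>u\<in>B m. y + u \<in> W}"
    show "openin S ?V"
      unfolding openS P_def
    proof
      fix y assume "y \<in> ?V"
      then obtain m where m: "\<forall>u\<in>B m. y + u \<in> W" by blast
      obtain k where k: "\<forall>u\<in>B k. \<forall>v\<in>B k. u + v \<in> B m" using half by blast
      have "\<forall>u\<in>B k. \<forall>v\<in>B k. (y + u) + v \<in> W" using m k by (simp add: add.assoc)
      then show "\<exists>n. \<forall>u\<in>B n. y + u \<in> ?V" by blast
    qed
    show "x \<in> ?V" using W by blast
    show "?V \<subseteq> W" using B0 by force
  qed
  have nb: "nbhd_zero S W \<longleftrightarrow> (\<exists>n. B n \<subseteq> W)" for W
  proof
    assume "nbhd_zero S W"
    then obtain V where V: "P V" "0 \<in> V" "V \<subseteq> W" unfolding nbhd_zero_def openS by blast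
    then obtain n where "\<forall>u\<in>B n. 0 + u \<in> V" unfolding P_def by blast
    with V show "\<exists>n. B n \<subseteq> W" by auto
  next
    assume "\<exists>n. B n \<subseteq> W"
    then obtain n where "B n \<subseteq> W" by blast
    then have "\<forall>u\<in>B n. 0 + u \<in> W" by auto
    from inner[OF this] show "nbhd_zero S W" unfolding nbhd_zero_def .
  qed
  have gt: "group_topology S"
    unfolding group_topology_def
  proof (intro conjI)
    show "continuous_map (prod_topology S S) S (\<lambda>(x, y). x + y)"
      unfolding continuous_map_def
    proof (intro conjI allI impI)
      fix W assume "openin S W"
      show "openin (prod_topology S S) {p \<in> topspace (prod_topology S S). (case p of (x, y) \<Rightarrow> x + y) \<in> W}"
        unfolding openin_prod_topology_alt
      proof (intro allI impI)
        fix x y assume "(x, y) \<in> {p \<in> topspace (prod_topology S S). (case p of (x, y) \<Rightarrow> x + y) \<in> W}"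
        then have "x + y \<in> W" by simp
        then obtain n where n: "\<forall>u\<in>B n. x + y + u \<in> W" using \<open>openin S W\<close> unfolding openS P_def by blast
        obtain m where m: "\<forall>u\<in>B m. \<forall>v\<in>B m. u + v \<in> B n" using half by blast
        obtain V1 where V1: "openin S V1" "x \<in> V1" "V1 \<subseteq> (+) x ` B m" using inner[of m x "(+) x ` B m"] by blast
        obtain V2 where V2: "openin S V2" "y \<in> V2" "V2 \<subseteq> (+) y ` B m" using inner[of m y "(+) y ` B m"] by blast
        have "a + b \<in> W" if ab: "a \<in> V1" "b \<in> V2" for a b
        proof -
          obtain u v where uv: "u \<in> B m" "v \<in> B m" "a = x + u" "b = y + v" using ab V1(3) V2(3) by blast
          then have "x + y + (u + v) \<in> W" using n m by blast
          then show ?thesis using uv by (simp add: algebra_simps)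
        qed
        then show "\<exists>U V. openin S U \<and> openin S V \<and> x \<in> U \<and> y \<in> V \<and>
            U \<times> V \<subseteq> {p \<in> topspace (prod_topology S S). (case p of (x, y) \<Rightarrow> x + y) \<in> W}"
          using V1 V2 top by (intro exI[of _ V1] exI[of _ V2]) auto
      qed
    qed (simp add: top)
    show "continuous_map S S uminus"
      unfolding continuous_map_def
    proof (intro conjI allI impI)
      fix V assume V: "openin S V"
      show "openin S {x \<in> topspace S. - x \<in> V}"
        unfolding openS P_def
      proof
        fix x assume "x \<in> {x \<in> topspace S. - x \<in> V}"
        then obtain n where "\<forall>u\<in>B n. - x + u \<in> V" using V unfolding openS P_def by blast
        then have "\<forall>u\<in>B n. - x + - u \<in> V" using neg by blast
        then show "\<exists>n. \<forall>u\<in>B n. x + u \<in> {x \<in> topspace S. - x \<in> V}" by (auto simp: top)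
      qed
    qed (simp add: top)
  qed (rule top)
  have "Hausdorff_space S"
    unfolding Hausdorff_space_def
  proof (intro allI impI)
    fix x y assume "x \<in> topspace S \<and> y \<in> topspace S \<and> x \<noteq> y"
    then have "x - y \<noteq> 0" by simp
    then obtain n where n: "x - y \<notin> B n" using sep by blast
    obtain m where m: "\<forall>u\<in>B m. \<forall>v\<in>B m. u + v \<in> B n" using half by blast
    obtain V1 where V1: "openin S V1" "x \<in> V1" "V1 \<subseteq> (+) x ` B m" using inner[of m x "(+) x ` B m"] by blast
    obtain V2 where V2: "openin S V2" "y \<in> V2" "V2 \<subseteq> (+) y ` B m" using inner[of m y "(+) y ` B m"] by blast
    have "disjnt V1 V2"
      unfolding disjnt_iff
    proof (intro allI notI)
      fix z assume "z \<in> V1 \<and> z \<in> V2"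
      then obtain u v where uv: "u \<in> B m" "v \<in> B m" "z = x + u" "z = y + v" using V1(3) V2(3) by blast
      then have "x - y = v + - u" by (metis add_diff_cancel_left' add_diff_cancel_right' diff_add_eq diff_conv_add_uminus diff_diff_add)
      moreover have "- u \<in> B m" using uv neg by blast
      ultimately show False using uv m n by metis
    qed
    then show "\<exists>U V. openin S U \<and> openin S V \<and> x \<in> U \<and> y \<in> V \<and> disjnt U V" using V1 V2 by blast
  qed
  with gt nb show thesis by (intro that[of S]) auto
qed

lemma inv_mult_subset: "n \<ge> 1 \<Longrightarrow> inv_mult n U \<subseteq> U"
  by (force simp: inv_mult_def)

lemma inv_mult_antimono: "m \<le> n \<Longrightarrow> inv_mult n U \<subseteq> inv_mult m U"
  by (auto simp: inv_mult_def)

text \<open>Halving at the first scale propagates to all scales: if \<open>z\<close> is in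
  \<open>inv_mult (2 * n) U\<close> and \<open>1 \<le> k \<le> n\<close>, then
  \<open>nmult k z\<close> is in \<open>inv_mult 2 U\<close>.\<close>

lemma UFSS_from_inv_mult:
  assumes U0: "0 \<in> U" and sym: "uminus ` U = U"
    and half: "\<And>x y. x \<in> inv_mult 2 U \<Longrightarrow> y \<in> inv_mult 2 U \<Longrightarrow> x + y \<in> U"
    and sep: "\<And>x. (\<And>n. x \<in> inv_mult n U) \<Longrightarrow> x = 0"
  obtains S where "UFSS S" "\<forall>W. nbhd_zero S W \<longleftrightarrow> (\<exists>n\<ge>1. inv_mult n U \<subseteq> W)"
proof -
  \<comment> \<open>The shift skips \<open>inv_mult 0 U\<close>, which is the whole group.\<close>
  define B where "B n = inv_mult (Suc n) U" for n
  have neg: "- x \<in> U" if "x \<in> U" for x using sym that by blast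
  obtain S where S: "group_topology S" "Hausdorff_space S" "\<forall>W. nbhd_zero S W \<longleftrightarrow> (\<exists>n. B n \<subseteq> W)"
  proof (rule group_topology_from_base)
    show "0 \<in> B n" for n using U0 by (simp add: B_def inv_mult_def)
    show "B n \<subseteq> B m" if "m \<le> n" for m n using that by (simp add: B_def inv_mult_antimono)
    show "- x \<in> B n" if "x \<in> B n" for x n
      using that neg by (simp add: B_def inv_mult_def nmult_minus_right)
    show "\<exists>m. \<forall>x\<in>B m. \<forall>y\<in>B m. x + y \<in> B n" for n
    proof (intro exI ballI)
      fix x y assume xy: "x \<in> B (2 * n + 1)" "y \<in> B (2 * n + 1)"
      have *: "nmult k z \<in> inv_mult 2 U" if z: "z \<in> B (2 * n + 1)" and k: "k \<in> {1..Suc n}" for z k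
        unfolding inv_mult_def mem_Collect_eq
      proof
        fix j :: nat assume j: "j \<in> {1..2}"
        have "j * k \<le> 2 * Suc n" using j k by (intro mult_mono) auto
        moreover have "1 \<le> j * k" using j k by simp
        ultimately show "nmult j (nmult k z) \<in> U" using z by (simp add: nmult_nmult B_def inv_mult_def)
      qed
      show "x + y \<in> B n"
        using half[OF *[OF xy(1)] *[OF xy(2)]] by (auto simp: B_def inv_mult_def nmult_add_right)
    qed
    show "x = 0" if "\<And>n. x \<in> B n" for x
    proof (rule sep)
      fix n show "x \<in> inv_mult n U" using that[of n] inv_mult_antimono[of n "Suc n" U] by (auto simp: B_def)
    qed
  qed
  have nb: "nbhd_zero S W \<longleftrightarrow> (\<exists>n\<ge>1. inv_mult n U \<subseteq> W)" for W
    unfolding S(3)[rule_format] B_def by (metis Suc_le_D One_nat_def le_add1 plus_1_eq_Suc)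
  have "UFSS S"
    unfolding UFSS_def
  proof (intro conjI exI[of _ U])
    show "nbhd_zero S U" using nb inv_mult_subset[of 1 U] order_refl by blast
    show "\<forall>n\<ge>1. nbhd_zero S (inv_mult n U)" using nb by blast
    show "\<forall>W. nbhd_zero S W \<longrightarrow> (\<exists>n\<ge>1. inv_mult n U \<subseteq> W)" using nb by blast
  qed (use S sym in auto)
  then show thesis using nb by (intro that) auto
qed

section \<open>Comparison of group topologies and discreteness\<close>

lemma nbhd_zeroI: "openin T V \<Longrightarrow> 0 \<in> V \<Longrightarrow> nbhd_zero T V"
  unfolding nbhd_zero_def by blast

text \<open>Translations are homeomorphisms of both topologies, so neighborhoods of \<open>0\<close>
  decide the comparison.\<close>

lemma group_topology_finerI:
  assumes S: "group_topology S" and T: "group_topology T"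
    and nb: "\<And>V. openin T V \<Longrightarrow> 0 \<in> V \<Longrightarrow> nbhd_zero S V"
    and V: "openin T V"
  shows "openin S V"
proof (subst openin_subopen, intro ballI)
  fix x assume "x \<in> V"
  then have "0 \<in> (+) (- x) ` V" by force
  with nb openin_translation[OF T V] have "nbhd_zero S ((+) (- x) ` V)" by blast
  then obtain V' where V': "openin S V'" "0 \<in> V'" "V' \<subseteq> (+) (- x) ` V" unfolding nbhd_zero_def by blast
  have "openin S ((+) x ` V')" by (rule openin_translation[OF S V'(1)])
  moreover have "x \<in> (+) x ` V'" using V'(2) by force
  moreover have "(+) x ` V' \<subseteq> V" using V'(3) by (auto simp: subset_iff)
  ultimately show "\<exists>W. openin S W \<and> x \<in> W \<and> W \<subseteq> V" by blast
qed

lemma group_topology_discrete_iff: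
  assumes S: "group_topology S"
  shows "S = discrete_topology UNIV \<longleftrightarrow> nbhd_zero S {0}"
proof
  assume "nbhd_zero S {0}"
  then have "openin S {0}" unfolding nbhd_zero_def by (metis insert_absorb subset_singleton_iff empty_iff)
  then have "openin S {x}" for x using openin_translation[OF S, of "{0}" x] by simp
  then show "S = discrete_topology UNIV"
    by (metis S discrete_topology_unique group_topology_topspace)
qed (simp add: nbhd_zeroI)

lemma UFSS_discrete_if_finite_exponent:
  assumes S: "UFSS S" and K: "add_subgroup K" "openin S K" "finite_exponent K"
  shows "S = discrete_topology UNIV"
proof -
  have gt: "group_topology S" and haus: "Hausdorff_space S" using S by (simp_all add: UFSS_def)
  obtain U where U: "nbhd_zero S U" "\<And>n. n \<ge> 1 \<Longrightarrow> nbhd_zero S (inv_mult n U)"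
    "\<And>W. nbhd_zero S W \<Longrightarrow> \<exists>n\<ge>1. inv_mult n U \<subseteq> W"
    using S unfolding UFSS_def by blast
  from finite_exponentE[OF K(3)] obtain N where N: "N \<ge> 1" "\<forall>x\<in>K. nmult N x = 0" .
  obtain m where m: "m \<ge> 1" "inv_mult m U \<subseteq> K" using U(3) nbhd_zeroI[OF K(2) add_subgroup_0[OF K(1)]] by blast
  have U0: "0 \<in> U" using U(1) by (auto simp: nbhd_zero_def)
  \<comment> \<open>The bound \<open>m\<close> puts \<open>x\<close> into \<open>K\<close>, so that
    its multiples repeat with period \<open>N\<close>; the bound \<open>N\<close> puts a full period
    into \<open>U\<close>. The residue \<open>0\<close> is treated apart, because
    \<open>inv_mult\<close> controls only multiples from \<open>1\<close> on.\<close>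
  have "inv_mult (max m N) U \<subseteq> {0}"
  proof
    fix x assume x: "x \<in> inv_mult (max m N) U"
    then have "x \<in> K" using m inv_mult_antimono[of m "max m N" U] by auto
    have kU: "nmult k x \<in> U" for k
    proof (cases "k mod N = 0")
      case True
      then show ?thesis using nmult_mod[of N x k] N \<open>x \<in> K\<close> U0 by simp
    next
      case False
      have "k mod N \<le> max m N" using N mod_less_divisor[of N k] by linarith
      then have "nmult (k mod N) x \<in> U" using x False by (auto simp: inv_mult_def)
      then show ?thesis using nmult_mod[of N x k] N \<open>x \<in> K\<close> by simp
    qed
    \<comment> \<open>All multiples of \<open>x\<close> lie in \<open>U\<close>, so \<open>x\<close>
      lies in every \<open>(1/n)U\<close>, hence in every neighborhood of \<open>0\<close>.\<close>
    show "x \<in> {0}"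
    proof (rule ccontr)
      assume "x \<notin> {0}"
      then obtain V W where VW: "openin S V" "openin S W" "0 \<in> V" "x \<in> W" "disjnt V W"
        using haus group_topology_topspace[OF gt] unfolding Hausdorff_space_def by (metis UNIV_I insertI1)
      then obtain n where "n \<ge> 1" "inv_mult n U \<subseteq> V" using U(3) nbhd_zeroI by metis
      moreover have "x \<in> inv_mult n U" using kU by (simp add: inv_mult_def)
      ultimately show False using VW by (auto simp: disjnt_iff)
    qed
  qed
  moreover have "nbhd_zero S (inv_mult (max m N) U)" using U(2) m(1) by simp
  ultimately have "nbhd_zero S {0}" unfolding nbhd_zero_def by blast
  then show ?thesis using group_topology_discrete_iff[OF gt] by blast
qed

section \<open>Neighborhood chains and null sequences with independent bounded combinations\<close>

text \<open>Metrizability enters through first countability; dependent choice shrinks a countable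
  local base to a symmetric chain that halves at each step.\<close>

lemma exists_nbhd_chain:
  assumes T: "group_topology T" and m: "metrizable_space T"
  obtains W :: "nat \<Rightarrow> 'a::ab_group_add set" where "\<forall>i. openin T (W i)" "\<forall>i. 0 \<in> W i"
    "\<forall>i. \<forall>x\<in>W i. - x \<in> W i" "\<forall>i. \<forall>x\<in>W (Suc i). \<forall>y\<in>W (Suc i). x + y \<in> W i"
    "\<forall>V. openin T V \<longrightarrow> 0 \<in> V \<longrightarrow> (\<exists>i. W i \<subseteq> V)"
proof -
  note [simp] = group_topology_topspace[OF T]
  have "first_countable T" using m by (rule metrizable_imp_first_countable)
  then obtain \<B> where \<B>: "countable \<B>" "\<And>V. V \<in> \<B> \<Longrightarrow> openin T V"
    "\<And>U. openin T U \<Longrightarrow> 0 \<in> U \<Longrightarrow> \<exists>V\<in>\<B>. 0 \<in> V \<and> V \<subseteq> U"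
    unfolding first_countable_def by (metis UNIV_I group_topology_topspace[OF T])
  define \<C> where "\<C> = {V \<in> \<B>. 0 \<in> V}"
  have "\<C> \<noteq> {}" using \<B>(3)[of UNIV] openin_topspace[of T] by (auto simp: \<C>_def)
  moreover have "countable \<C>" using \<B>(1) by (simp add: \<C>_def)
  ultimately have ran: "range (from_nat_into \<C>) = \<C>" by (rule range_from_nat_into)
  define B where "B = from_nat_into \<C>"
  have B: "openin T (B n)" "0 \<in> B n" for n using ran \<B>(2) by (auto simp: B_def \<C>_def)
  let ?P = "\<lambda>n X. openin T X \<and> 0 \<in> X \<and> (\<forall>x\<in>X. - x \<in> X) \<and> X \<subseteq> B n"
  have sym: "\<exists>Y. ?P n Y \<and> Y \<subseteq> X" if X: "openin T X" "0 \<in> X" for X n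
  proof -
    have "openin T (X \<inter> B n)" using X B by blast
    from openin_group_preimage[OF T continuous_map_group_minus[OF T continuous_map_id] this]
    have "openin T {a. - a \<in> X \<inter> B n}" by (simp only: id_apply)
    then have "openin T (X \<inter> B n \<inter> {a. - a \<in> X \<inter> B n})" using X B by blast
    then show ?thesis using X B by (intro exI[of _ "X \<inter> B n \<inter> {a. - a \<in> X \<inter> B n}"]) auto
  qed
  have "\<exists>W. \<forall>n. ?P n (W n) \<and> (\<forall>x\<in>W (Suc n). \<forall>y\<in>W (Suc n). x + y \<in> W n)"
  proof (rule dependent_nat_choice)
    show "\<exists>X. ?P 0 X" using sym[OF B(1,2), of 0] by blast
  next
    fix X n assume "?P n X"
    then have X: "openin T X" "0 \<in> X" by simp_all
    from openin_half[OF T X] obtain V where V: "openin T V" "0 \<in> V" "\<forall>x\<in>V. \<forall>y\<in>V. x + y \<in> X" .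
    from sym[OF V(1,2), of "Suc n"] obtain Y where Y: "?P (Suc n) Y" "Y \<subseteq> V" by blast
    then have "\<forall>x\<in>Y. \<forall>y\<in>Y. x + y \<in> X" using V(3) by blast
    with Y(1) show "\<exists>Y. ?P (Suc n) Y \<and> (\<forall>x\<in>Y. \<forall>y\<in>Y. x + y \<in> X)" by blast
  qed
  then obtain W where W: "\<forall>n. ?P n (W n) \<and> (\<forall>x\<in>W (Suc n). \<forall>y\<in>W (Suc n). x + y \<in> W n)" ..
  show thesis
  proof
    show "\<forall>V. openin T V \<longrightarrow> 0 \<in> V \<longrightarrow> (\<exists>i. W i \<subseteq> V)"
    proof (intro allI impI)
      fix V assume "openin T V" "0 \<in> V"
      then obtain X where "X \<in> \<C>" "X \<subseteq> V" using \<B>(3)[of V] by (auto simp: \<C>_def)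
      then obtain i where "B i \<subseteq> V" using ran unfolding B_def by (metis rangeE)
      moreover have "W i \<subseteq> B i" using W by simp
      ultimately show "\<exists>i. W i \<subseteq> V" by blast
    qed
  qed (use W in simp_all)
qed

text \<open>The sum is absorbed from its far end: the tail after the first term lies in
  \<open>W (Suc j)\<close>, as does the first term, so the whole lies in \<open>W j\<close>, however
  many terms there are.\<close>

lemma sum_in_nbhd_chain:
  fixes W :: "nat \<Rightarrow> 'a::ab_group_add set"
  assumes W0: "\<forall>i. 0 \<in> W i" and W: "\<forall>i. \<forall>x\<in>W (Suc i). \<forall>y\<in>W (Suc i). x + y \<in> W i"
    and w: "\<And>i. w i \<in> W i"
  shows "(\<Sum>i=Suc j..<Suc j + k. w i) \<in> W j"
proof (induction k arbitrary: j)
  case (Suc k)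
  have "(\<Sum>i=Suc j..<Suc j + Suc k. w i) = w (Suc j) + (\<Sum>i=Suc (Suc j)..<Suc (Suc j) + k. w i)"
    by (subst sum.atLeast_Suc_lessThan) auto
  also have "\<dots> \<in> W j" using W w Suc.IH by blast
  finally show ?case .
qed (use W0 in simp)

text \<open>Keeps the set to be avoided finite at each stage of the recursive choice of
  \<open>y\<close>.\<close>

lemma finite_bounded_combinations:
  fixes y :: "nat \<Rightarrow> 'a::ab_group_add" and b :: "nat \<Rightarrow> int"
  shows "finite {\<Sum>j<n. zmult (c j) (y j) | c. \<forall>j<n. \<bar>c j\<bar> \<le> b j}"
proof (induction n)
  case (Suc n)
  have "{\<Sum>j<Suc n. zmult (c j) (y j) | c. \<forall>j<Suc n. \<bar>c j\<bar> \<le> b j} \<subseteq>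
      (\<lambda>(h, k). h + zmult k (y n)) ` ({\<Sum>j<n. zmult (c j) (y j) | c. \<forall>j<n. \<bar>c j\<bar> \<le> b j} \<times> {- b n..b n})"
  proof
    fix h assume "h \<in> {\<Sum>j<Suc n. zmult (c j) (y j) | c. \<forall>j<Suc n. \<bar>c j\<bar> \<le> b j}"
    then obtain c where c: "h = (\<Sum>j<Suc n. zmult (c j) (y j))" "\<forall>j<Suc n. \<bar>c j\<bar> \<le> b j" by blast
    have "(\<Sum>j<n. zmult (c j) (y j), c n) \<in>
        {\<Sum>j<n. zmult (c j) (y j) | c. \<forall>j<n. \<bar>c j\<bar> \<le> b j} \<times> {- b n..b n}"
    proof (rule SigmaI)
      show "(\<Sum>j<n. zmult (c j) (y j)) \<in> {\<Sum>j<n. zmult (c j) (y j) | c. \<forall>j<n. \<bar>c j\<bar> \<le> b j}"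
        using c(2) less_SucI by blast
      have "\<bar>c n\<bar> \<le> b n" using c(2) by blast
      then show "c n \<in> {- b n..b n}" by auto
    qed
    then show "h \<in> (\<lambda>(h, k). h + zmult k (y n)) `
        ({\<Sum>j<n. zmult (c j) (y j) | c. \<forall>j<n. \<bar>c j\<bar> \<le> b j} \<times> {- b n..b n})"
      by (rule rev_image_eqI) (simp add: c(1))
  qed
  then show ?case by (rule finite_subset) (simp add: Suc.IH)
qed simp

text \<open>Each \<open>y i\<close> is chosen so that no multiple up to \<open>3 * Suc i\<close> is
  a bounded combination of earlier terms; the last nonzero coefficient of a vanishing combination
  would contradict this. The factor \<open>3\<close> leaves room to compare coefficients of weight
  at most \<open>2\<close> with coefficients of weight at most \<open>1\<close>.\<close>

lemma exists_independent_null_sequence: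
  fixes W :: "nat \<Rightarrow> 'a::ab_group_add set"
  assumes W: "\<And>i. \<forall>x\<in>W i. - x \<in> W i" "\<And>i. 0 \<in> W i"
    and avoid: "\<And>i n F. finite F \<Longrightarrow> \<exists>x\<in>inv_mult (Suc i) (W i). \<forall>k\<in>{1..n}. nmult k x \<notin> F"
  obtains y where "\<forall>i k. \<bar>k\<bar> \<le> int (Suc i) \<longrightarrow> zmult k (y i) \<in> W i"
    "\<forall>n c. (\<Sum>j<n. zmult (c j) (y j)) = 0 \<longrightarrow> (\<forall>j<n. \<bar>c j\<bar> \<le> 3 * int (Suc j)) \<longrightarrow> (\<forall>j<n. c j = 0)"
proof -
  define F where "F y n = {\<Sum>j<n. zmult (c j) (y j) | c. \<forall>j<n. \<bar>c j\<bar> \<le> 3 * int (Suc j)}"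
    for y :: "nat \<Rightarrow> 'a" and n
  have "\<exists>y. \<forall>i. y i \<in> inv_mult (Suc i) (W i) \<and> (\<forall>k\<in>{1..3 * Suc i}. nmult k (y i) \<notin> F y i)"
  \<comment> \<open>Course-of-values recursion: \<open>F y i\<close> depends on all terms before
    \<open>i\<close> and, as the first goal states, on no others.\<close>
  proof (rule dependent_wellorder_choice[where P = "\<lambda>y i r. r \<in> inv_mult (Suc i) (W i) \<and>
        (\<forall>k\<in>{1..3 * Suc i}. nmult k r \<notin> F y i)"])
    fix r :: 'a and f g :: "nat \<Rightarrow> 'a" and i :: nat
    assume "\<And>j. j < i \<Longrightarrow> f j = g j"
    then have "F f i = F g i" by (simp add: F_def cong: sum.cong_simp)
    then show "(r \<in> inv_mult (Suc i) (W i) \<and> (\<forall>k\<in>{1..3 * Suc i}. nmult k r \<notin> F f i)) =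
        (r \<in> inv_mult (Suc i) (W i) \<and> (\<forall>k\<in>{1..3 * Suc i}. nmult k r \<notin> F g i))" by simp
  next
    fix i :: nat and f :: "nat \<Rightarrow> 'a"
    have "finite (F f i)" unfolding F_def by (rule finite_bounded_combinations)
    from avoid[OF this] show "\<exists>r. r \<in> inv_mult (Suc i) (W i) \<and> (\<forall>k\<in>{1..3 * Suc i}. nmult k r \<notin> F f i)"
      by blast
  qed
  then obtain y where y: "\<And>i. y i \<in> inv_mult (Suc i) (W i)"
    "\<And>i k. k \<in> {1..3 * Suc i} \<Longrightarrow> nmult k (y i) \<notin> F y i" by blast
  show thesis
  proof (intro that allI impI)
    fix i k assume k: "\<bar>k\<bar> \<le> int (Suc i)"
    have *: "nmult n (y i) \<in> W i" if "n \<le> Suc i" for n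
      using y(1)[of i] that W(2) by (cases "n = 0") (auto simp: inv_mult_def)
    have **: "nat \<bar>k\<bar> \<le> Suc i" using k by simp
    show "zmult k (y i) \<in> W i"
    proof (cases "k \<ge> 0")
      case True
      then show ?thesis using *[OF **] zmult_of_nat[of "nat k" "y i"] by simp
    next
      case False
      then have "zmult k (y i) = - nmult (nat \<bar>k\<bar>) (y i)" by (simp add: zmult_def)
      then show ?thesis using *[OF **] W(1) by simp
    qed
  next
    have "\<forall>j<n. c j = 0" if "(\<Sum>j<n. zmult (c j) (y j)) = 0" "\<forall>j<n. \<bar>c j\<bar> \<le> 3 * int (Suc j)" for n c
      using that
    proof (induction n)
      case (Suc n)
      have "c n = 0"
      proof (rule ccontr)
        assume "c n \<noteq> 0"
        let ?k = "nat \<bar>c n\<bar>"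
        have "\<bar>c n\<bar> \<le> 3 * int (Suc n)" using Suc.prems(2) by blast
        then have "?k \<in> {1..3 * Suc n}" using \<open>c n \<noteq> 0\<close> by auto
        moreover have "nmult ?k (y n) \<in> F y n"
        proof -
          have eq: "zmult (c n) (y n) = - (\<Sum>j<n. zmult (c j) (y j))"
            using Suc.prems(1) by (simp add: add_eq_0_iff)
          have k: "nmult ?k (y n) = zmult \<bar>c n\<bar> (y n)" using zmult_of_nat[of ?k "y n"] by simp
          have "\<exists>d. nmult ?k (y n) = (\<Sum>j<n. zmult (d j) (y j)) \<and> (\<forall>j<n. \<bar>d j\<bar> \<le> 3 * int (Suc j))"
          proof (cases "c n > 0")
            case True
            then have "nmult ?k (y n) = (\<Sum>j<n. zmult (- c j) (y j))"
              unfolding k using eq by (simp add: zmult_minus sum_negf)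
            moreover have "\<forall>j<n. \<bar>- c j\<bar> \<le> 3 * int (Suc j)" using Suc.prems(2) by simp
            ultimately show ?thesis by (intro exI[of _ "\<lambda>j. - c j"]) simp
          next
            case False
            then have "nmult ?k (y n) = (\<Sum>j<n. zmult (c j) (y j))"
              unfolding k using eq by (simp add: zmult_minus)
            moreover have "\<forall>j<n. \<bar>c j\<bar> \<le> 3 * int (Suc j)" using Suc.prems(2) by simp
            ultimately show ?thesis by (intro exI[of _ c]) simp
          qed
          then show ?thesis unfolding F_def by blast
        qed
        ultimately show False using y(2) by blast
      qed
      have "(\<Sum>j<n. zmult (c j) (y j)) = 0" using Suc.prems(1) \<open>c n = 0\<close> by simp
      moreover have "\<forall>j<n. \<bar>c j\<bar> \<le> 3 * int (Suc j)" using Suc.prems(2) less_SucI by blast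
      ultimately have "\<forall>j<n. c j = 0" by (rule Suc.IH)
      with \<open>c n = 0\<close> show ?case using less_Suc_eq by blast
    qed simp
    then show "c j = 0" if "(\<Sum>j<n. zmult (c j) (y j)) = 0" "\<forall>j<n. \<bar>c j\<bar> \<le> 3 * int (Suc j)" "j < n" for n c j
      using that by blast
  qed
qed

section \<open>The unit ball of a weighted independent sequence\<close>

context
  fixes y :: "nat \<Rightarrow> 'a::ab_group_add"
  assumes indep: "\<forall>n c. (\<Sum>j<n. zmult (c j) (y j)) = 0 \<longrightarrow>
    (\<forall>j<n. \<bar>c j\<bar> \<le> 3 * int (Suc j)) \<longrightarrow> (\<forall>j<n. c j = 0)"
begin

text \<open>Only the even terms of \<open>y\<close> are used; the odd ones will show that the topology
  constructed from \<open>wt_ball\<close> differs from the given one.\<close>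

definition represents :: "(nat \<Rightarrow> int) \<Rightarrow> nat \<Rightarrow> 'a \<Rightarrow> bool" where
  "represents c n h \<longleftrightarrow> (\<forall>i. odd i \<or> n \<le> i \<longrightarrow> c i = 0) \<and> h = (\<Sum>i<n. zmult (c i) (y i))"

text \<open>Weight at most \<open>1\<close> forces \<open>\<bar>c i\<bar> \<le> Suc i\<close>, the
  range in which the multiples of \<open>y i\<close> are controlled, while \<open>y i\<close> itself
  gets a weight that tends to \<open>0\<close>.\<close>

definition wt :: "(nat \<Rightarrow> int) \<Rightarrow> nat \<Rightarrow> real" where
  "wt c n = (\<Sum>i<n. \<bar>real_of_int (c i)\<bar> / real (Suc i))"

definition wt_ball :: "'a set" where
  "wt_ball = {h. \<exists>c n. represents c n h \<and> wt c n \<le> 1}"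

lemma represents_mono:
  assumes "represents c n h" "n \<le> m"
  shows "represents c m h" "wt c m = wt c n"
proof -
  have c0: "c i = 0" if "i \<in> {..<m} - {..<n}" for i using assms that by (auto simp: represents_def)
  have "(\<Sum>i<m. zmult (c i) (y i)) = (\<Sum>i<n. zmult (c i) (y i))"
    using assms(2) by (intro sum.mono_neutral_right) (auto simp: c0)
  then show "represents c m h" using assms by (auto simp: represents_def)
  show "wt c m = wt c n"
    unfolding wt_def using assms(2) by (intro sum.mono_neutral_right) (auto simp: c0)
qed

lemma represents_0: "represents (\<lambda>_. 0) 0 0"
  by (simp add: represents_def)

lemma represents_add:
  "represents c n g \<Longrightarrow> represents d n h \<Longrightarrow> represents (\<lambda>i. c i + d i) n (g + h)"
  by (auto simp: represents_def zmult_add sum.distrib)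

lemma represents_minus: "represents c n h \<Longrightarrow> represents (\<lambda>i. - c i) n (- h)"
  by (auto simp: represents_def zmult_minus sum_negf)

lemma represents_nmult: "represents c n h \<Longrightarrow> represents (\<lambda>i. int k * c i) n (nmult k h)"
  by (auto simp: represents_def nmult_sum nmult_zmult)

lemma wt_nonneg: "0 \<le> wt c n"
  by (auto simp: wt_def intro!: sum_nonneg)

lemma wt_minus [simp]: "wt (\<lambda>i. - c i) n = wt c n"
  by (simp add: wt_def)

lemma wt_add_le: "wt (\<lambda>i. c i + d i) n \<le> wt c n + wt d n"
  unfolding wt_def sum.distrib[symmetric] add_divide_distrib[symmetric]
  by (intro sum_mono divide_right_mono) auto

lemma wt_nmult: "wt (\<lambda>i. int k * c i) n = real k * wt c n"
  by (simp add: wt_def sum_distrib_left abs_mult)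

lemma abs_coeff_le_wt:
  assumes "i < n"
  shows "\<bar>real_of_int (c i)\<bar> \<le> wt c n * real (Suc i)"
proof -
  have "\<bar>real_of_int (c i)\<bar> / real (Suc i) \<le> wt c n"
    unfolding wt_def using assms by (intro member_le_sum) auto
  then show ?thesis by (simp add: field_simps)
qed

lemma abs_coeff_le:
  assumes "i < n" "wt c n \<le> real k"
  shows "\<bar>c i\<bar> \<le> int k * int (Suc i)"
proof -
  have "\<bar>real_of_int (c i)\<bar> \<le> wt c n * real (Suc i)" by (rule abs_coeff_le_wt[OF assms(1)])
  also have "\<dots> \<le> real k * real (Suc i)" using assms(2) by (intro mult_right_mono) auto
  finally have "real_of_int \<bar>c i\<bar> \<le> real_of_int (int k * int (Suc i))" by simp
  then show ?thesis by (simp only: of_int_le_iff)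
qed

text \<open>The difference of the coefficients has weight at most \<open>3\<close>, so
  \<open>indep\<close> applies to it.\<close>

lemma represents_unique:
  assumes c: "represents c n h" and d: "represents d n h" and le: "wt c n + wt d n \<le> 3"
  shows "c = d"
proof
  fix i
  let ?e = "\<lambda>i. c i + - d i"
  have e: "represents ?e n (h + - h)" by (rule represents_add[OF c represents_minus[OF d]])
  have "wt ?e n \<le> wt c n + wt (\<lambda>i. - d i) n" by (rule wt_add_le)
  then have "wt ?e n \<le> real 3" using le by simp
  then have "\<forall>j<n. \<bar>?e j\<bar> \<le> 3 * int (Suc j)" using abs_coeff_le[of _ n ?e 3] by simp
  moreover have "(\<Sum>j<n. zmult (?e j) (y j)) = 0" using e by (simp add: represents_def)
  ultimately have "\<forall>j<n. ?e j = 0" using indep[rule_format, of ?e n] by blast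
  then show "c i = d i" using c d by (cases "i < n") (auto simp: represents_def)
qed

text \<open>By induction, the coefficients \<open>Suc k * c i\<close> of
  \<open>nmult (Suc k) h\<close> have weight at most \<open>2\<close>. Membership in the ball
  supplies coefficients of weight at most \<open>1\<close>; together this is within the range of
  \<open>represents_unique\<close>, so the two agree and the weight is in fact at most
  \<open>1\<close>.\<close>

lemma wt_le_if_multiples_in_ball:
  assumes c: "represents c n h" "wt c n \<le> 1" and h: "h \<in> inv_mult m wt_ball" and k: "1 \<le> k" "k \<le> m"
  shows "real k * wt c n \<le> 1"
  using k
proof (induction k rule: dec_induct)
  case (step k)
  have IH: "real k * wt c n \<le> 1" using step by simp
  have "nmult (Suc k) h \<in> wt_ball" using h step by (auto simp: inv_mult_def)
  then obtain d n' where d: "represents d n' (nmult (Suc k) h)" "wt d n' \<le> 1"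
    unfolding wt_ball_def by blast
  define l where "l = max n n'"
  have cl: "represents c l h" "wt c l = wt c n" using represents_mono[OF c(1), of l] by (simp_all add: l_def)
  have dl: "represents d l (nmult (Suc k) h)" "wt d l = wt d n'"
    using represents_mono[OF d(1), of l] by (simp_all add: l_def)
  have el: "represents (\<lambda>i. int (Suc k) * c i) l (nmult (Suc k) h)" by (rule represents_nmult[OF cl(1)])
  have wl: "wt (\<lambda>i. int (Suc k) * c i) l = real (Suc k) * wt c n" by (simp only: wt_nmult cl(2))
  have "real (Suc k) * wt c n = real k * wt c n + wt c n" by (simp add: algebra_simps)
  then have "wt d l + wt (\<lambda>i. int (Suc k) * c i) l \<le> 3" using wl dl(2) d(2) c(2) IH by linarith
  from represents_unique[OF dl(1) el this] have "wt d l = real (Suc k) * wt c n" by (simp only: wl)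
  then show ?case using dl(2) d(2) by simp
qed (use c in simp)

text \<open>Identifies \<open>(1/m)U\<close> with the ball of radius \<open>1/m\<close>, which opens
  it to the triangle inequality for \<open>wt\<close>.\<close>

lemma inv_mult_ball_iff:
  assumes "m \<ge> 1"
  shows "h \<in> inv_mult m wt_ball \<longleftrightarrow> (\<exists>c n. represents c n h \<and> real m * wt c n \<le> 1)"
proof
  assume h: "h \<in> inv_mult m wt_ball"
  then have "h \<in> wt_ball" using assms inv_mult_subset by blast
  then obtain c n where "represents c n h" "wt c n \<le> 1" unfolding wt_ball_def by blast
  then show "\<exists>c n. represents c n h \<and> real m * wt c n \<le> 1"
    using wt_le_if_multiples_in_ball[OF _ _ h assms] by blast
next
  assume "\<exists>c n. represents c n h \<and> real m * wt c n \<le> 1"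
  then obtain c n where c: "represents c n h" "real m * wt c n \<le> 1" by blast
  show "h \<in> inv_mult m wt_ball"
    unfolding inv_mult_def mem_Collect_eq
  proof
    fix k assume k: "k \<in> {1..m}"
    have "real k * wt c n \<le> real m * wt c n" using k wt_nonneg by (intro mult_right_mono) auto
    then have "wt (\<lambda>i. int k * c i) n \<le> 1" using c(2) by (simp add: wt_nmult)
    then show "nmult k h \<in> wt_ball" using represents_nmult[OF c(1), of k] unfolding wt_ball_def by blast
  qed
qed

lemma wt_ball_add:
  assumes "g \<in> inv_mult 2 wt_ball" "h \<in> inv_mult 2 wt_ball"
  shows "g + h \<in> wt_ball"
proof -
  obtain c m where c: "represents c m g" "2 * wt c m \<le> 1" using inv_mult_ball_iff[of 2 g] assms(1) by auto
  obtain d n where d: "represents d n h" "2 * wt d n \<le> 1" using inv_mult_ball_iff[of 2 h] assms(2) by auto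
  define l where "l = max m n"
  have cl: "represents c l g" "wt c l = wt c m" using represents_mono[OF c(1), of l] by (simp_all add: l_def)
  have dl: "represents d l h" "wt d l = wt d n" using represents_mono[OF d(1), of l] by (simp_all add: l_def)
  have "wt (\<lambda>i. c i + d i) l \<le> 1" using wt_add_le[of c d l] cl(2) dl(2) c(2) d(2) by linarith
  then show ?thesis using represents_add[OF cl(1) dl(1)] unfolding wt_ball_def by blast
qed

lemma wt_ball_symmetric: "uminus ` wt_ball = wt_ball"
proof -
  have *: "- h \<in> wt_ball" if "h \<in> wt_ball" for h
    using that represents_minus unfolding wt_ball_def by fastforce
  show ?thesis
  proof
    show "wt_ball \<subseteq> uminus ` wt_ball"
    proof
      fix h assume "h \<in> wt_ball"
      then show "h \<in> uminus ` wt_ball" using *[of h] by (intro image_eqI[of _ _ "- h"]) auto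
    qed
  qed (use * in blast)
qed

lemma zero_in_wt_ball: "0 \<in> wt_ball"
proof -
  have "wt (\<lambda>_. 0) 0 \<le> 1" by (simp add: wt_def)
  then show ?thesis using represents_0 unfolding wt_ball_def by blast
qed

lemma eq_0_if_in_all_inv_mult:
  assumes h: "\<And>n. h \<in> inv_mult n wt_ball"
  shows "h = 0"
proof -
  have "h \<in> wt_ball" using h[of 1] inv_mult_subset[of 1] by auto
  then obtain c n where c: "represents c n h" "wt c n \<le> 1" unfolding wt_ball_def by blast
  have *: "real k * wt c n \<le> 1" if "k \<ge> 1" for k
    using wt_le_if_multiples_in_ball[OF c h[of k] that] by simp
  have "wt c n = 0"
  proof (rule ccontr)
    assume "wt c n \<noteq> 0"
    then have "wt c n > 0" using wt_nonneg[of c n] by simp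
    then obtain k where k: "1 < real k * wt c n" using reals_Archimedean3 by blast
    then have "k \<ge> 1" by (cases k) auto
    with *[OF this] k show False by simp
  qed
  then have "c i = 0" if "i < n" for i using abs_coeff_le_wt[OF that, of c] by simp
  then show ?thesis using c(1) by (simp add: represents_def)
qed

text \<open>A coefficient with index \<open>i \<le> j\<close> is bounded by
  \<open>(j + 1) / (j + 2) < 1\<close>, hence is \<open>0\<close>; the remaining terms lie in the
  \<open>W i\<close> with \<open>i > j\<close>, and their sum lies in \<open>W j\<close>.\<close>

lemma inv_mult_ball_subset_nbhd:
  assumes W0: "\<forall>i. 0 \<in> W i" and W: "\<forall>i. \<forall>x\<in>W (Suc i). \<forall>y\<in>W (Suc i). x + y \<in> W i"
    and yW: "\<forall>i k. \<bar>k\<bar> \<le> int (Suc i) \<longrightarrow> zmult k (y i) \<in> W i"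
  shows "inv_mult (j + 2) wt_ball \<subseteq> W j"
proof
  fix h assume "h \<in> inv_mult (j + 2) wt_ball"
  then obtain c n0 where c0: "represents c n0 h" "real (j + 2) * wt c n0 \<le> 1"
    using inv_mult_ball_iff[of "j + 2" h] by auto
  \<comment> \<open>Padding by \<open>Suc j\<close> ensures that all indices up to \<open>j\<close>
    lie below \<open>n\<close> and gives the tail the shape that \<open>sum_in_nbhd_chain\<close>
    expects.\<close>
  define n where "n = Suc j + n0"
  have c: "represents c n h" "real (j + 2) * wt c n \<le> 1"
    using represents_mono[OF c0(1), of n] c0(2) by (simp_all add: n_def)
  have "wt c n \<le> real (j + 2) * wt c n" using wt_nonneg[of c n] mult_right_mono[of 1 "real (j + 2)" "wt c n"] by simp
  then have "wt c n \<le> real 1" using c(2) by simp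
  then have cW: "zmult (c i) (y i) \<in> W i" for i
    using yW abs_coeff_le[of i n c 1] c(1) W0 by (cases "i < n") (auto simp: represents_def)
  have c_small: "c i = 0" if "i \<le> j" for i
  proof (rule ccontr)
    assume "c i \<noteq> 0"
    then have "1 \<le> \<bar>real_of_int (c i)\<bar>" by (metis abs_ge_zero of_int_abs of_int_le_iff of_int_1 zero_less_abs_iff int_one_le_iff_zero_less)
    also have "\<dots> \<le> wt c n * real (Suc i)" using that by (intro abs_coeff_le_wt) (simp add: n_def)
    also have "\<dots> \<le> wt c n * real (j + 1)" using that wt_nonneg by (intro mult_left_mono) auto
    finally have *: "1 \<le> wt c n * real (j + 1)" .
    then have "wt c n > 0" using wt_nonneg[of c n] by (cases "wt c n = 0") auto
    with * c(2) show False by (simp add: algebra_simps)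
  qed
  have "h = (\<Sum>i<n. zmult (c i) (y i))" using c(1) by (simp add: represents_def)
  also have "\<dots> = (\<Sum>i=Suc j..<Suc j + n0. zmult (c i) (y i))"
    by (rule sum.mono_neutral_right) (auto simp: n_def c_small)
  also have "\<dots> \<in> W j" by (rule sum_in_nbhd_chain[OF W0 W cW])
  finally show "h \<in> W j" .
qed

lemma unit_sum: "(\<Sum>j<Suc i. zmult (if j = i then 1 else 0) (y j)) = y i"
proof -
  have "(\<Sum>j<i. zmult (if j = i then 1 else 0) (y j)) = 0" by (intro sum.neutral) auto
  then show ?thesis by simp
qed

lemma y_nonzero: "y i \<noteq> 0"
proof
  assume "y i = 0"
  then have "\<forall>j<Suc i. (if j = i then 1 else 0 :: int) = 0"
    using indep[rule_format, of "\<lambda>j. if j = i then 1 else 0" "Suc i"] unit_sum[of i] by auto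
  then show False by auto
qed

text \<open>Since \<open>y (2 * m)\<close> is nonzero, no \<open>(1/m)U\<close> is trivial and the
  new topology is not discrete.\<close>

lemma even_term_in_inv_mult: "y (2 * m) \<in> inv_mult m wt_ball"
proof (cases "m = 0")
  case False
  define c where "c j = (if j = 2 * m then 1 else 0 :: int)" for j
  have "represents c (Suc (2 * m)) (y (2 * m))"
    using unit_sum[of "2 * m"] by (auto simp: represents_def c_def)
  moreover have "wt c (Suc (2 * m)) = 1 / real (Suc (2 * m))"
  proof -
    have "(\<Sum>i<2 * m. \<bar>real_of_int (c i)\<bar> / real (Suc i)) = 0" by (intro sum.neutral) (auto simp: c_def)
    then show ?thesis by (simp add: wt_def c_def)
  qed
  moreover have "real m * (1 / real (Suc (2 * m))) \<le> 1" by (simp add: field_simps)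
  ultimately show ?thesis using inv_mult_ball_iff[of m] False by (metis Suc_le_eq One_nat_def not_gr_zero)
qed (simp add: inv_mult_def)

text \<open>Elements of the ball have coefficient \<open>0\<close> at odd indices, whereas
  independence would force the coefficient \<open>1\<close> at \<open>2 * m + 1\<close>. The odd
  terms tend to \<open>0\<close> in the given topology, so the ball is no neighborhood of
  \<open>0\<close> there.\<close>

lemma odd_term_notin_wt_ball: "y (2 * m + 1) \<notin> wt_ball"
proof
  assume "y (2 * m + 1) \<in> wt_ball"
  then obtain c n0 where c0: "represents c n0 (y (2 * m + 1))" "wt c n0 \<le> 1" unfolding wt_ball_def by blast
  define n where "n = max n0 (2 * m + 2)"
  have c: "represents c n (y (2 * m + 1))" "wt c n \<le> real 1"
    using represents_mono[OF c0(1), of n] c0(2) by (simp_all add: n_def)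
  define u where "u j = (if j = 2 * m + 1 then 1 else 0 :: int)" for j
  have "(\<Sum>j<n. zmult (u j) (y j)) = (\<Sum>j<Suc (2 * m + 1). zmult (u j) (y j))"
    by (rule sum.mono_neutral_right) (auto simp: n_def u_def)
  also have "\<dots> = y (2 * m + 1)" unfolding u_def by (rule unit_sum)
  finally have "(\<Sum>j<n. zmult (c j - u j) (y j)) = 0"
    using c(1) by (simp add: represents_def zmult_diff sum_subtractf)
  moreover have "\<bar>c j - u j\<bar> \<le> 3 * int (Suc j)" if "j < n" for j
    using abs_coeff_le[OF that c(2)] by (auto simp: u_def)
  ultimately have "\<forall>j<n. c j - u j = 0" using indep[rule_format, of "\<lambda>j. c j - u j" n] by blast
  then have "c (2 * m + 1) = 1" by (auto simp: u_def n_def)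
  moreover have "c (2 * m + 1) = 0" using c(1) by (simp add: represents_def)
  ultimately show False by simp
qed

end

section \<open>Construction of the finer topology and proof of the equivalence\<close>

lemma exists_strictly_finer_UFSS:
  fixes T :: "'a::ab_group_add topology"
  assumes T: "group_topology T" and haus: "Hausdorff_space T" and loc: "locally_compact_space T"
    and met: "metrizable_space T"
    and nK: "\<not> (\<exists>K. add_subgroup K \<and> openin T K \<and> compactin T K \<and> finite_exponent K)"
  shows "\<exists>S. UFSS S \<and> S \<noteq> discrete_topology UNIV \<and> strictly_finer S T"
proof -
  from exists_nbhd_chain[OF T met] obtain W where W: "\<forall>i. openin T (W i)" "\<forall>i. 0 \<in> W i"
    "\<forall>i. \<forall>x\<in>W i. - x \<in> W i" "\<forall>i. \<forall>x\<in>W (Suc i). \<forall>y\<in>W (Suc i). x + y \<in> W i"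
    "\<forall>V. openin T V \<longrightarrow> 0 \<in> V \<longrightarrow> (\<exists>i. W i \<subseteq> V)" .
  \<comment> \<open>Choosing \<open>x\<close> in \<open>inv_mult (Suc i) (W i)\<close> keeps its
    multiples up to \<open>Suc i\<close> inside \<open>W i\<close>.\<close>
  have avoid: "\<exists>x\<in>inv_mult (Suc i) (W i). \<forall>k\<in>{1..n}. nmult k x \<notin> F" if "finite F" for i n F
  proof (rule exists_multiples_avoiding_finite_set[OF T haus loc nK _ _ that])
    show "openin T (inv_mult (Suc i) (W i))" using openin_inv_mult[OF T] W(1) by blast
    show "0 \<in> inv_mult (Suc i) (W i)" using W(2) by (simp add: inv_mult_def)
  qed
  obtain y where y: "\<forall>i k. \<bar>k\<bar> \<le> int (Suc i) \<longrightarrow> zmult k (y i) \<in> W i"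
    and indep: "\<forall>n c. (\<Sum>j<n. zmult (c j) (y j)) = 0 \<longrightarrow>
      (\<forall>j<n. \<bar>c j\<bar> \<le> 3 * int (Suc j)) \<longrightarrow> (\<forall>j<n. c j = 0)"
    by (rule exists_independent_null_sequence[of W]) (use W(2,3) avoid in auto)
  let ?U = "wt_ball y"
  obtain S where S: "UFSS S" "\<forall>V. nbhd_zero S V \<longleftrightarrow> (\<exists>n\<ge>1. inv_mult n ?U \<subseteq> V)"
    by (rule UFSS_from_inv_mult[of ?U])
      (use zero_in_wt_ball[OF indep] wt_ball_symmetric[OF indep] wt_ball_add[OF indep] eq_0_if_in_all_inv_mult[OF indep] in auto)
  have gt: "group_topology S" using S(1) by (simp add: UFSS_def)
  have "openin S V" if "openin T V" for V
  proof (rule group_topology_finerI[OF gt T _ that])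
    fix V assume "openin T V" "0 \<in> V"
    then obtain j where "W j \<subseteq> V" using W(5) by blast
    then have "inv_mult (j + 2) ?U \<subseteq> V" using inv_mult_ball_subset_nbhd[OF indep W(2,4) y, of j] by blast
    moreover have "j + 2 \<ge> 1" by simp
    ultimately show "nbhd_zero S V" using S(2) by blast
  qed
  moreover have "S \<noteq> T"
  proof
    assume "S = T"
    have "nbhd_zero S ?U" using S(2) inv_mult_subset[of 1 ?U] by auto
    then obtain j where j: "W j \<subseteq> ?U" using W(5) \<open>S = T\<close> unfolding nbhd_zero_def by (meson order_trans)
    have "W (i + k) \<subseteq> W i" for i k
    proof (induction k)
      case (Suc k)
      have "W (Suc (i + k)) \<subseteq> W (i + k)" using W(2,4) by (metis add_0 subsetI)
      with Suc show ?case by auto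
    qed simp
    \<comment> \<open>Any odd index that is at least \<open>j\<close> would do here.\<close>
    from this[of j "j + 1"] have "W (2 * j + 1) \<subseteq> ?U" using j by (simp add: mult_2)
    moreover have "y (2 * j + 1) \<in> W (2 * j + 1)" using y[rule_format, of 1 "2 * j + 1"] by simp
    ultimately show False using odd_term_notin_wt_ball[OF indep, of j] by blast
  qed
  moreover have "S \<noteq> discrete_topology UNIV"
  proof
    assume "S = discrete_topology UNIV"
    then have "nbhd_zero S {0}" by (rule iffD1[OF group_topology_discrete_iff[OF gt]])
    then obtain n where "inv_mult n ?U \<subseteq> {0}" using S(2) by blast
    then show False using even_term_in_inv_mult[OF indep, of n] y_nonzero[OF indep, of "2 * n"] by blast
  qed
  ultimately show ?thesis using S(1) unfolding strictly_finer_def by blast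
qed

theorem corollary4p24:
  fixes T :: "'a::ab_group_add topology"
  assumes "group_topology T"
    and "Hausdorff_space T"
    and "locally_compact_space T"
    and "metrizable_space T"
  shows "((\<exists>S. UFSS S \<and> S \<noteq> discrete_topology UNIV \<and> strictly_finer S T) \<longleftrightarrow>
          \<not> (\<exists>K. add_subgroup K \<and> openin T K \<and> compactin T K \<and> finite_exponent K))
       \<and> (\<not> totally_disconnected_space T \<longrightarrow>
          (\<exists>S. UFSS S \<and> S \<noteq> discrete_topology UNIV \<and> strictly_finer S T))"
proof -
  have reg: "completely_regular_space T" using assms(4) by (rule metrizable_imp_completely_regular_space)
  \<comment> \<open>An open subgroup for \<open>T\<close> stays open in the finer \<open>S\<close>
    and would make \<open>S\<close> discrete.\<close>
  have "\<not> (\<exists>K. add_subgroup K \<and> openin T K \<and> compactin T K \<and> finite_exponent K)"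
    if "UFSS S" "S \<noteq> discrete_topology UNIV" "strictly_finer S T" for S
    using UFSS_discrete_if_finite_exponent[OF that(1)] that(2,3) unfolding strictly_finer_def by blast
  \<comment> \<open>By contraposition, a group that is not totally disconnected falls under the
    equivalence.\<close>
  moreover have "totally_disconnected_space T"
    if "\<exists>K. add_subgroup K \<and> openin T K \<and> compactin T K \<and> finite_exponent K"
    using totally_disconnected_if_compact_open_torsion_subgroup[OF assms(1,2) reg] that by blast
  ultimately show ?thesis using exists_strictly_finer_UFSS[OF assms] by blast
qed

end
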